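(* Let $F\subset\mathbb{R}^p$ be a connected self-similar set and let $0<\alpha<1$. Then there exists a dense $G_\delta$ set $\mathcal{G}$ in $C_1^\alpha(F)$ such that for every $f\in\mathcal{G}$ $$D_*(\alpha,F)=D_*^f(F)=D^f(r,F)\quad\text{for Lebesgue almost every } r\in f(F).$$
   Context: A self-similar set is a non-empty compact set $F\subset\mathbb{R}^p$ with $F=\bigcup_{i=1}^m\varphi_i(F)$, where $m\ge 2$ and $\varphi_1,\dots,\varphi_m$ are contractive similarities of $\mathbb{R}^p$ with ratios $0<\mathbf{q}_1,\dots,\mathbf{q}_m<1$; the Open Set Condition is not assumed. A function $f:F\to\mathbb{R}$ is $1$-Hölder-$\alpha$ if $|f(x)-f(y)|\le |x-y|^\alpha$ for all $x,y\in F$. $C_1^\alpha(F)$ denotes the set of all $1$-Hölder-$\alpha$ functions on $F$, equipped with the metric of the supremum norm. $\lambda$ is one-dimensional Lebesgue measure and $\dim_H$ is Hausdorff dimension (with $\dim_H\emptyset=\inf\{s\ge 0:\mathcal H^s(\emptyset)=0\}=0$). For $f:F\to\mathbb{R}$ and $r\in\mathbb{R}$ put $D^f(r,F)=\dim_H(f^{-1}(r))$ and $$D_*^f(F)=\sup\{d:\lambda\{r: D^f(r,F)\ge d\}>0\}.$$ Let $\mathfrak{G}_{1,\alpha}(F)$ be the family of all dense $G_\delta$ subsets of $C_1^\alpha(F)$, and set $$D_*(\alpha,F)=\sup_{\mathcal{G}\in\mathfrak{G}_{1,\alpha}(F)}\inf\{D_*^f(F): f\in\mathcal{G}\}.$$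 *)

theory Defs
  imports "HOL-Analysis.Analysis"
begin

section \<open>Hausdorff measure and Hausdorff dimension\<close>

text \<open>
  The power \<open>(diam U)\<^sup>s\<close> with the usual conventions: the empty set contributes \<open>0\<close>, and
  a nonempty set has zeroth power \<open>1\<close>, also if its diameter is \<open>0\<close>. The case distinction is
  needed because \<open>0 powr 0 = 0\<close> in HOL.
\<close>

definition diam_pow :: "real \<Rightarrow> 'a::metric_space set \<Rightarrow> ennreal" where
  "diam_pow s U = (if U = {} then 0 else if s = 0 then 1 else ennreal (diameter U powr s))"

text \<open>
  Boundedness of the covering sets is required explicitly because \<^const>\<open>diameter\<close> is
  meaningless for unbounded sets. Finite covers are included, as the \<open>U i\<close> may be empty.
\<close>

definition hausdorff_premeasure :: "real \<Rightarrow> real \<Rightarrow> 'a::metric_space set \<Rightarrow> ennreal" where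
  "hausdorff_premeasure s \<delta> A =
     (INF U \<in> {U :: nat \<Rightarrow> 'a set. A \<subseteq> (\<Union>i. U i) \<and> (\<forall>i. bounded (U i) \<and> diameter (U i) \<le> \<delta>)}.
        \<Sum>i. diam_pow s (U i))"

definition hausdorff_measure :: "real \<Rightarrow> 'a::metric_space set \<Rightarrow> ennreal" where
  "hausdorff_measure s A = (SUP \<delta> \<in> {0<..}. hausdorff_premeasure s \<delta> A)"

definition hausdorff_dim :: "'a::metric_space set \<Rightarrow> ennreal" where
  "hausdorff_dim A = (INF s \<in> {s. 0 \<le> s \<and> hausdorff_measure s A = 0}. ennreal s)"


section \<open>Self-similar sets\<close>

definition similarity_with_ratio :: "real \<Rightarrow> ('a::metric_space \<Rightarrow> 'a) \<Rightarrow> bool" where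
  "similarity_with_ratio q \<phi> \<longleftrightarrow> (\<forall>x y. dist (\<phi> x) (\<phi> y) = q * dist x y)"

definition self_similar_set :: "(real ^ 'p) set \<Rightarrow> bool" where
  "self_similar_set F \<longleftrightarrow>
     F \<noteq> {} \<and> compact F \<and>
     (\<exists>(m::nat) (\<phi> :: nat \<Rightarrow> real ^ 'p \<Rightarrow> real ^ 'p) (q :: nat \<Rightarrow> real).
        2 \<le> m \<and>
        (\<forall>i\<in>{1..m}. 0 < q i \<and> q i < 1 \<and> similarity_with_ratio (q i) (\<phi> i)) \<and>
        F = (\<Union>i\<in>{1..m}. \<phi> i ` F))"


section \<open>The metric space of 1-Hoelder functions\<close>

text \<open>
  A function \<open>F \<rightarrow> \<real>\<close> is represented by its extension to the whole type that is
  \<^const>\<open>undefined\<close> outside \<open>F\<close>, as in \<^const>\<open>funspace\<close>; thus distinct representatives are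
  distinct functions on \<open>F\<close>.
\<close>

definition holder1 :: "real \<Rightarrow> 'a::metric_space set \<Rightarrow> ('a \<Rightarrow> real) set" where
  "holder1 \<alpha> F = {f \<in> extensional F. \<forall>x\<in>F. \<forall>y\<in>F. \<bar>f x - f y\<bar> \<le> dist x y powr \<alpha>}"

text \<open>
  \<^term>\<open>funspace F euclidean_metric\<close> carries the supremum metric, but contains only the
  bounded functions; on a compact \<open>F\<close> this excludes nothing, see below.
\<close>

definition holder1_metric :: "real \<Rightarrow> 'a::metric_space set \<Rightarrow> ('a \<Rightarrow> real) metric" where
  "holder1_metric \<alpha> F = submetric (funspace F euclidean_metric) (holder1 \<alpha> F)"

lemma mspace_holder1_metric:
  assumes "compact F" "0 < \<alpha>"
  shows "mspace (holder1_metric \<alpha> F) = holder1 \<alpha> F"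
proof -
  have "bounded (f ` F)" if f: "f \<in> holder1 \<alpha> F" for f
  proof -
    obtain a C where C: "\<And>x. x \<in> F \<Longrightarrow> dist a x \<le> C"
      using compact_imp_bounded[OF assms(1)] unfolding bounded_def by blast
    have "dist (f x) (f y) \<le> (2 * C) powr \<alpha>" if "x \<in> F" "y \<in> F" for x y
    proof -
      have "dist x y \<le> 2 * C"
        using dist_triangle3[of x y a] C[OF that(1)] C[OF that(2)] by linarith
      hence "dist x y powr \<alpha> \<le> (2 * C) powr \<alpha>"
        using assms(2) by (intro powr_mono2) auto
      moreover have "dist (f x) (f y) \<le> dist x y powr \<alpha>"
        using f that by (auto simp: holder1_def dist_real_def)
      ultimately show ?thesis by linarith
    qed
    thus ?thesis
      unfolding bounded_two_points by blast
  qed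
  thus ?thesis
    by (auto simp: holder1_metric_def Metric_space.fspace_def[OF Met_TC.Metric_space_axioms]
        holder1_def)
qed

lemma mdist_holder1_metric:
  assumes "compact F" "F \<noteq> {}" "0 < \<alpha>" "f \<in> holder1 \<alpha> F" "g \<in> holder1 \<alpha> F"
  shows "mdist (holder1_metric \<alpha> F) f g = (SUP x\<in>F. \<bar>f x - g x\<bar>)"
proof -
  have "f \<in> Met_TC.fspace F" "g \<in> Met_TC.fspace F"
    using mspace_holder1_metric[OF assms(1,3)] assms(4,5) by (auto simp: holder1_metric_def)
  thus ?thesis
    using assms(2) by (simp add: holder1_metric_def Met_TC.fdist_def dist_real_def)
qed

definition dense_gdeltas :: "real \<Rightarrow> 'a::metric_space set \<Rightarrow> ('a \<Rightarrow> real) set set" where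
  "dense_gdeltas \<alpha> F =
     {\<G>. gdelta_in (mtopology_of (holder1_metric \<alpha> F)) \<G> \<and>
         mtopology_of (holder1_metric \<alpha> F) closure_of \<G> = mspace (holder1_metric \<alpha> F)}"


section \<open>Dimensions of level sets\<close>

definition level_dim :: "('a::metric_space \<Rightarrow> real) \<Rightarrow> real \<Rightarrow> 'a set \<Rightarrow> ennreal" where
  "level_dim f r F = hausdorff_dim {x \<in> F. f x = r}"

text \<open>
  For continuous \<open>f\<close> on a compact \<open>F\<close> the function \<open>r \<mapsto> level_dim f r F\<close> is Borel, so the sets
  measured here are measurable whenever \<open>f\<close> is in \<^term>\<open>holder1 \<alpha> F\<close> with \<open>\<alpha> > 0\<close>.
  For \<open>d = 0\<close> the set is all of \<open>\<real>\<close>, also containing those \<open>r\<close> whose level set is empty.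
\<close>

definition D_star_fun :: "('a::metric_space \<Rightarrow> real) \<Rightarrow> 'a set \<Rightarrow> ennreal" where
  "D_star_fun f F = Sup {d. emeasure lebesgue {r. level_dim f r F \<ge> d} > 0}"

definition D_star :: "real \<Rightarrow> 'a::metric_space set \<Rightarrow> ennreal" where
  "D_star \<alpha> F = (SUP \<G> \<in> dense_gdeltas \<alpha> F. INF f \<in> \<G>. D_star_fun f F)"

end

theory Submission
  imports Defs
begin

text \<open>
  The proof rests on a zero-one law for each exponent \<open>s > 0\<close> (\<open>generic_null_or_full\<close>): either,
  for generic \<open>f\<close>, the \<open>s\<close>-dimensional Hausdorff measure of \<open>f\<^sup>-\<^sup>1(r)\<close> vanishes for almost every \<open>r\<close>,
  or, for generic \<open>f\<close>, it is nonzero for almost every \<open>r \<in> f(F)\<close>. By Baire's theorem the generic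
  alternatives for all rational \<open>s\<close> hold simultaneously. So there is one number \<open>d\<close>, the supremum
  of the exponents of the second kind, which for generic \<open>f\<close> is the dimension of \<open>f\<^sup>-\<^sup>1(r)\<close> for
  almost every \<open>r \<in> f(F)\<close>. Unless \<open>F\<close> is a point, a generic \<open>f\<close> is not constant, \<open>f(F)\<close> is an interval of
  positive length, and hence \<open>D\<^sub>*\<^sup>f(F) = d\<close>. As two dense \<open>G\<^sub>\<delta>\<close> sets always meet, \<open>D\<^sub>*(\<alpha>,F) = d\<close>.

  For the zero-one law, replace the Hausdorff measure by the Hausdorff content, which has the same
  null sets. By compactness of \<open>F\<close>, the condition that the content of \<open>f\<^sup>-\<^sup>1(r)\<close> is small is
  open in \<open>(f, r)\<close>. It follows that the set of \<open>f\<close> for which the values \<open>r\<close> with content at least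
  \<open>1/n\<close> have measure less than \<open>1/n\<close> is open. If all these sets are dense, the first alternative
  holds. Otherwise one of them misses a ball: there are \<open>f\<^sub>1\<close> and \<open>\<eta> > 0\<close> such that all functions
  close to \<open>f\<^sub>1\<close> have a set of measure at least \<open>\<eta>\<close> of values with content at least \<open>\<eta>\<close>.

  Self-similarity turns this local lower bound into a global one (\<open>insert_copies\<close>). Given any \<open>f\<close>
  whose range contains \<open>[a, b]\<close>, choose many equally spaced values \<open>r\<^sub>i\<close> in \<open>[a, b]\<close> and points
  \<open>x\<^sub>i\<close> with \<open>f(x\<^sub>i) = r\<^sub>i\<close>, which exist because \<open>F\<close> is connected. Around each \<open>x\<^sub>i\<close>, on a small
  similar copy of \<open>F\<close>, replace \<open>f\<close> by \<open>r\<^sub>i\<close> plus a rescaled \<open>f\<^sub>1\<close>. The scale is chosen so that the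
  ranges on the copies are disjoint but fill a fixed proportion of \<open>[a, b]\<close>. The values with
  non-null level sets then have proportion at least \<open>\<kappa>\<close> in \<open>[a, b]\<close>, and this persists under
  small perturbations. Here \<open>\<kappa>\<close> must depend neither on \<open>[a, b]\<close> nor on the allowed size of the
  change of \<open>f\<close>. To achieve this, \<open>f\<close> is first approximated by a Lipschitz function: since
  \<open>\<alpha> < 1\<close>, such a function is far from exhausting the Hoelder condition at small scales, and this
  leaves room for the copies. So, generically, the values with non-null level sets have proportion at
  least \<open>\<kappa>\<close> in every interval contained in \<open>f(F)\<close>, and by regularity of Lebesgue measure they
  have full measure in \<open>f(F)\<close> (\<open>full_measure_if_uniform_proportion\<close>).
\<close>


section \<open>Generic properties in the space of 1-Hoelder functions\<close>

locale holder_functions =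
  fixes F :: "'a::metric_space set" and \<alpha> :: real
  assumes compact_F: "compact F" and F_nonempty: "F \<noteq> {}"
    and alpha_pos: "0 < \<alpha>" and alpha_less_1: "\<alpha> < 1"
begin

abbreviation "X \<equiv> holder1 \<alpha> F"
abbreviation "XT \<equiv> mtopology_of (holder1_metric \<alpha> F)"

text \<open>
  The closed balls of the supremum metric, through which its topology is described below.
\<close>
definition close :: "real \<Rightarrow> ('a \<Rightarrow> real) \<Rightarrow> ('a \<Rightarrow> real) \<Rightarrow> bool" where
  "close e f g \<longleftrightarrow> (\<forall>x\<in>F. \<bar>f x - g x\<bar> \<le> e)"

lemma mspace_eq: "mspace (holder1_metric \<alpha> F) = X"
  by (rule mspace_holder1_metric[OF compact_F alpha_pos])

lemma mdist_le_iff_close: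
  assumes "f \<in> X" "g \<in> X"
  shows "mdist (holder1_metric \<alpha> F) f g \<le> e \<longleftrightarrow> close e f g"
proof -
  have "f \<in> mspace (funspace F euclidean_metric)" "g \<in> mspace (funspace F euclidean_metric)"
    using assms mspace_eq unfolding holder1_metric_def by auto
  then show ?thesis
    using funspace_mdist_le[of f F euclidean_metric g e] F_nonempty
    by (simp add: holder1_metric_def close_def dist_real_def)
qed

lemma openin_iff:
  "openin XT U \<longleftrightarrow> U \<subseteq> X \<and> (\<forall>f\<in>U. \<exists>e>0. \<forall>g\<in>X. close e f g \<longrightarrow> g \<in> U)"
proof -
  interpret Metric_space X "mdist (holder1_metric \<alpha> F)"
    using Metric_space_mspace_mdist[of "holder1_metric \<alpha> F"] by (simp add: mspace_eq)
  have "openin XT U \<longleftrightarrow> openin mtopology U"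
    by (simp add: mtopology_of_def mspace_eq)
  also have "\<dots> \<longleftrightarrow> U \<subseteq> X \<and> (\<forall>f\<in>U. \<exists>e>0. \<forall>g\<in>X. close e f g \<longrightarrow> g \<in> U)"
    unfolding openin_mtopology_mcball mcball_def using mdist_le_iff_close by blast
  finally show ?thesis .
qed

lemma dense_iff:
  "XT closure_of U = X \<longleftrightarrow> (\<forall>f\<in>X. \<forall>e>0. \<exists>g\<in>U \<inter> X. close e f g)"
proof -
  interpret Metric_space X "mdist (holder1_metric \<alpha> F)"
    using Metric_space_mspace_mdist[of "holder1_metric \<alpha> F"] by (simp add: mspace_eq)
  have "XT closure_of U = mtopology closure_of U"
    by (simp add: mtopology_of_def mspace_eq)
  also have "\<dots> = X \<longleftrightarrow> (\<forall>f\<in>X. \<forall>e>0. \<exists>g\<in>U. g \<in> mcball f e)"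
    unfolding metric_closure_of_alt by auto
  also have "\<dots> \<longleftrightarrow> (\<forall>f\<in>X. \<forall>e>0. \<exists>g\<in>U \<inter> X. close e f g)"
    unfolding mcball_def using mdist_le_iff_close by blast
  finally show ?thesis .
qed

text \<open>
  The Hoelder condition is preserved under pointwise limits, so \<^term>\<open>X\<close> is a closed subset of the
  complete space of bounded functions. Completeness is what Baire's theorem needs.
\<close>
lemma mcomplete_holder1: "mcomplete_of (holder1_metric \<alpha> F)"
proof -
  let ?m = "funspace F (euclidean_metric :: real metric)"
  have comp: "mcomplete_of ?m"
  proof -
    interpret E: Metric_space "mspace (euclidean_metric :: real metric)" "mdist (euclidean_metric :: real metric)"
      by (rule Metric_space_mspace_mdist)
    have "E.mcomplete"
      using complete_UNIV by simp
    from E.mcomplete_funspace[OF this, where S = F] show ?thesis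
      unfolding mcomplete_of_def mspace_funspace mdist_funspace E.mspace_Self E.mdist_Self .
  qed
  interpret Metric_space "mspace ?m" "mdist ?m"
    by (rule Metric_space_mspace_mdist)
  have X_sub: "X \<subseteq> mspace ?m"
    using mspace_eq by (auto simp: holder1_metric_def)
  interpret S: Submetric "mspace ?m" "mdist ?m" X
    using X_sub by unfold_locales
  have "closedin mtopology X"
    unfolding closedin_def topspace_mtopology openin_mtopology_mcball
  proof (intro conjI allI impI)
    show "X \<subseteq> mspace ?m" by (rule X_sub)
    fix f assume f: "f \<in> mspace ?m - X"
    then obtain x y where xy: "x \<in> F" "y \<in> F" "dist x y powr \<alpha> < \<bar>f x - f y\<bar>"
      using funspace_imp_extensional[of f F euclidean_metric] unfolding holder1_def
      by (auto simp: not_le)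
    define e where "e = (\<bar>f x - f y\<bar> - dist x y powr \<alpha>) / 3"
    have e: "e > 0" using xy by (simp add: e_def)
    have "g \<notin> X" if "g \<in> mspace ?m" "mdist ?m f g \<le> e" for g
    proof
      assume "g \<in> X"
      then have "\<bar>g x - g y\<bar> \<le> dist x y powr \<alpha>" using xy by (auto simp: holder1_def)
      moreover have "\<bar>f x - g x\<bar> \<le> e" "\<bar>f y - g y\<bar> \<le> e"
        using that f Urysohn.funspace_mdist_le[of f F euclidean_metric g e] F_nonempty xy
        by (auto simp: dist_real_def)
      moreover have "3 * e = \<bar>f x - f y\<bar> - dist x y powr \<alpha>" by (simp add: e_def)
      ultimately show False using e by linarith
    qed
    then show "\<exists>r>0. mcball f r \<subseteq> mspace ?m - X"
      using e f by (intro exI[of _ e]) (auto simp del: mspace_funspace mdist_funspace)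
  qed auto
  then have "S.sub.mcomplete"
    using S.closedin_mcomplete_imp_mcomplete comp by (simp add: mcomplete_of_def)
  then show ?thesis
    unfolding mcomplete_of_def mspace_eq by (simp add: holder1_metric_def)
qed

definition open_dense :: "('a \<Rightarrow> real) set \<Rightarrow> bool" where
  "open_dense U \<longleftrightarrow> openin XT U \<and> XT closure_of U = X"

text \<open>
  Comeagreness, phrased with open dense sets, so that countable intersections are immediate and
  Baire's theorem is only needed to pass to dense \<open>G\<^sub>\<delta>\<close> sets.
\<close>
definition generic :: "('a \<Rightarrow> real) set \<Rightarrow> bool" where
  "generic A \<longleftrightarrow> (\<exists>\<U>. countable \<U> \<and> (\<forall>U\<in>\<U>. open_dense U) \<and> X \<inter> \<Inter>\<U> \<subseteq> A)"

lemma open_dense_X: "open_dense X"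
proof -
  have "close e f f" if "e > 0" for e f
    using that by (simp add: close_def)
  then show ?thesis
    unfolding open_dense_def openin_iff dense_iff using zero_less_one by blast
qed

lemma open_dense_imp_generic: "open_dense U \<Longrightarrow> generic U"
  unfolding generic_def by (rule exI[of _ "{U}"]) auto

lemma generic_mono: "generic A \<Longrightarrow> X \<inter> A \<subseteq> B \<Longrightarrow> generic B"
  unfolding generic_def by (meson Int_lower1 Int_greatest order_trans)

lemma generic_CollectI: "generic A \<Longrightarrow> (\<And>f. f \<in> X \<Longrightarrow> f \<in> A \<Longrightarrow> P f) \<Longrightarrow> generic {f. P f}"
  by (rule generic_mono) auto

lemma generic_INT:
  assumes "countable I" "\<And>i. i \<in> I \<Longrightarrow> generic (A i)"
  shows "generic (\<Inter>i\<in>I. A i)"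
proof -
  obtain \<U> where \<U>: "\<And>i. i \<in> I \<Longrightarrow> countable (\<U> i) \<and> (\<forall>U\<in>\<U> i. open_dense U) \<and> X \<inter> \<Inter>(\<U> i) \<subseteq> A i"
    using assms(2) unfolding generic_def by metis
  show ?thesis
    unfolding generic_def
  proof (intro exI[of _ "\<Union>i\<in>I. \<U> i"] conjI)
    show "countable (\<Union>i\<in>I. \<U> i)" using assms(1) \<U> by blast
    show "\<forall>U\<in>(\<Union>i\<in>I. \<U> i). open_dense U" using \<U> by blast
    show "X \<inter> \<Inter> (\<Union>i\<in>I. \<U> i) \<subseteq> (\<Inter>i\<in>I. A i)"
    proof (intro INT_greatest)
      fix i assume "i \<in> I"
      then have "X \<inter> \<Inter> (\<Union>i\<in>I. \<U> i) \<subseteq> X \<inter> \<Inter> (\<U> i)" by auto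
      also have "\<dots> \<subseteq> A i" using \<U>[OF \<open>i \<in> I\<close>] by (elim conjE)
      finally show "X \<inter> \<Inter> (\<Union>i\<in>I. \<U> i) \<subseteq> A i" .
    qed
  qed
qed

lemma generic_Int: "generic A \<Longrightarrow> generic B \<Longrightarrow> generic (A \<inter> B)"
  using generic_INT[of "UNIV :: bool set" "\<lambda>i. if i then A else B"]
  by (simp add: UNIV_bool Int_commute)

lemma generic_contains_dense_gdelta:
  assumes "generic A"
  obtains G where "G \<in> dense_gdeltas \<alpha> F" "G \<subseteq> A" "G \<subseteq> X"
proof -
  obtain \<U> where \<U>: "countable \<U>" "\<forall>U\<in>\<U>. open_dense U" "X \<inter> \<Inter>\<U> \<subseteq> A"
    using assms unfolding generic_def by blast
  let ?V = "insert X \<U>"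
  have V: "countable ?V" "\<forall>U\<in>?V. open_dense U" using \<U> open_dense_X by auto
  interpret Metric_space X "mdist (holder1_metric \<alpha> F)"
    using Metric_space_mspace_mdist[of "holder1_metric \<alpha> F"] by (simp add: mspace_eq)
  have XT: "XT = mtopology" by (simp add: mtopology_of_def mspace_eq)
  have "mtopology closure_of \<Inter>?V = X"
    using metric_Baire_category[of ?V] V mcomplete_holder1
    by (auto simp: mcomplete_of_def mspace_eq open_dense_def XT)
  moreover have "gdelta_in mtopology (\<Inter>?V)"
    using V by (intro gdelta_in_Inter) (auto simp: open_dense_def XT intro: open_imp_gdelta_in)
  ultimately have "\<Inter>?V \<in> dense_gdeltas \<alpha> F"
    by (simp add: dense_gdeltas_def XT mspace_eq)
  with \<U>(3) show ?thesis by (intro that[of "\<Inter>?V"]) auto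
qed

text \<open>
  Every open set of a representation of \<open>G\<close> as a countable intersection contains \<open>G\<close> and is
  therefore dense.
\<close>
lemma dense_gdelta_generic:
  assumes "G \<in> dense_gdeltas \<alpha> F"
  shows "generic G"
proof -
  obtain \<U> where \<U>: "countable \<U>" "\<U> \<subseteq> Collect (openin XT)" "\<Inter>\<U> = G"
    using assms unfolding dense_gdeltas_def gdelta_in_alt intersection_of_def by auto
  have "open_dense U" if "U \<in> \<U>" for U
  proof -
    have "XT closure_of G \<subseteq> XT closure_of U" using \<U> that by (intro closure_of_mono) auto
    moreover have "XT closure_of U \<subseteq> X" 
      using closure_of_subset_topspace[of XT U] by (simp add: mspace_eq)
    ultimately show ?thesis
      using assms \<U> that unfolding open_dense_def dense_gdeltas_def by (auto simp: mspace_eq)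
  qed
  then show ?thesis unfolding generic_def using \<U> by blast
qed

lemma generic_nonempty:
  assumes "generic A" shows "A \<inter> X \<noteq> {}"
proof -
  obtain G where G: "G \<in> dense_gdeltas \<alpha> F" "G \<subseteq> A" "G \<subseteq> X"
    using generic_contains_dense_gdelta[OF assms] .
  let ?f = "\<lambda>x\<in>F. 0::real"
  have "?f \<in> X" by (auto simp: holder1_def)
  moreover have "XT closure_of G = X" using G by (simp add: dense_gdeltas_def mspace_eq)
  ultimately have "G \<noteq> {}" using closure_of_empty[of XT] by auto
  with G show ?thesis by blast
qed

end

section \<open>Hausdorff null sets and open coverings\<close>

text \<open>
  The \<open>s\<close>-dimensional Hausdorff content of \<open>A\<close> is less than \<open>e\<close>. The covering sets are open in order
  that a compact thin set stays thin after a small perturbation. Their diameters need no bound: for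
  \<open>s > 0\<close>, a small sum forces small diameters.
\<close>
definition thin :: "real \<Rightarrow> real \<Rightarrow> 'a::metric_space set \<Rightarrow> bool" where
  "thin s e A \<longleftrightarrow> (\<exists>U :: nat \<Rightarrow> 'a set. (\<forall>i. open (U i) \<and> bounded (U i)) \<and> A \<subseteq> (\<Union>i. U i) \<and>
     (\<Sum>i. diam_pow s (U i)) < ennreal e)"

lemma thin_mono: "thin s e A \<Longrightarrow> B \<subseteq> A \<Longrightarrow> e \<le> e' \<Longrightarrow> thin s e' B"
  unfolding thin_def by (meson ennreal_leI order_less_le_trans order_trans)

lemma thin_empty: "0 < e \<Longrightarrow> thin s e {}"
  unfolding thin_def by (rule exI[of _ "\<lambda>_. {}"]) (simp add: diam_pow_def)

lemma thin_neighbourhood: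
  assumes "thin s e A"
  obtains V where "open V" "A \<subseteq> V" "\<And>B. B \<subseteq> V \<Longrightarrow> thin s e B"
proof -
  obtain U where U: "\<forall>i. open (U i) \<and> bounded (U i)" "A \<subseteq> (\<Union>i. U i)" "(\<Sum>i. diam_pow s (U i)) < ennreal e"
    using assms unfolding thin_def by blast
  show ?thesis
    by (rule that[of "\<Union>i. U i"]) (use U in \<open>auto simp: thin_def\<close>)
qed

lemma diameter_le_metric:
  fixes S :: "'a::metric_space set"
  assumes "S \<noteq> {}" "\<And>x y. x \<in> S \<Longrightarrow> y \<in> S \<Longrightarrow> dist x y \<le> d"
  shows "diameter S \<le> d"
proof -
  have "(SUP (x, y)\<in>S \<times> S. dist x y) \<le> d"
    by (rule cSUP_least) (use assms in auto)
  then show ?thesis using assms(1) by (simp add: diameter_def)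
qed

text \<open>
  The neighbourhood of radius \<open>t\<close> has diameter at most \<open>diameter U + 2 t\<close>, and \<open>x powr s\<close> is
  continuous at \<open>diameter U\<close>, also if this is \<open>0\<close>.
\<close>
lemma enlarge_to_open:
  fixes U :: "'a::metric_space set"
  assumes "bounded U" "0 < s" "0 < e"
  obtains V where "open V" "bounded V" "U \<subseteq> V" "diam_pow s V \<le> diam_pow s U + ennreal e"
proof (cases "U = {}")
  case True
  then show ?thesis using that[of "{}"] by simp
next
  case False
  let ?d = "diameter U"
  have d: "0 \<le> ?d" using assms by (simp add: diameter_ge_0)
  have "((\<lambda>t. (?d + 2 * t) powr s) \<longlongrightarrow> (?d + 2 * 0) powr s) (at_right 0)"
    using d assms(2)
    by (intro tendsto_powr' tendsto_intros) (auto intro!: eventually_at_rightI[of 0 1])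
  then have "eventually (\<lambda>t. (?d + 2 * t) powr s < ?d powr s + e) (at_right 0)"
    using assms(3) by (intro order_tendstoD(2)[where y="(?d + 2 * 0) powr s"]) auto
  moreover have "eventually (\<lambda>t. t > (0::real)) (at_right 0)"
    by (simp add: eventually_at_right_less)
  ultimately have "eventually (\<lambda>t. t > 0 \<and> (?d + 2 * t) powr s < ?d powr s + e) (at_right 0)"
    by eventually_elim simp
  then obtain t where t: "t > 0" "(?d + 2 * t) powr s < ?d powr s + e"
    using eventually_happens[of _ "at_right (0::real)"] by auto
  define V where "V = (\<Union>x\<in>U. ball x t)"
  have V_dist: "dist x y \<le> ?d + 2 * t" if xy: "x \<in> V" "y \<in> V" for x y
  proof -
    obtain a b where ab: "a \<in> U" "b \<in> U" "dist a x < t" "dist b y < t"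
      using xy by (auto simp: V_def)
    have "dist a b \<le> ?d" using assms(1) ab by (intro diameter_bounded_bound)
    moreover have "dist x y \<le> dist a x + dist a b + dist b y"
      using dist_triangle[of x y a] dist_triangle[of a y b] by (simp add: dist_commute)
    ultimately show ?thesis using ab by linarith
  qed
  have UV: "U \<subseteq> V" using t by (auto simp: V_def)
  have "diameter V \<le> ?d + 2 * t"
    using V_dist UV False by (intro diameter_le_metric) auto
  moreover have bV: "bounded V" using V_dist unfolding bounded_two_points by blast
  ultimately have "diameter V powr s \<le> (?d + 2 * t) powr s"
    using assms(2) diameter_ge_0[of V] by (intro powr_mono2) auto
  then have "diameter V powr s \<le> ?d powr s + e"
    using t by linarith
  then have "diam_pow s V \<le> ennreal (?d powr s + e)"
    unfolding diam_pow_def using assms by (simp add: ennreal_leI del: ennreal_plus)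
  also have "\<dots> = diam_pow s U + ennreal e"
    using False assms by (simp add: diam_pow_def)
  finally show ?thesis using bV UV by (intro that[of V]) (auto simp: V_def)
qed

text \<open>
  The \<open>i\<close>-th set of an almost optimal cover is enlarged to an open set at a cost of a geometric
  series with sum \<open>e / 2\<close>.
\<close>
lemma premeasure_null_imp_thin:
  assumes "hausdorff_premeasure s \<delta> A = 0" "0 < s" "0 < e"
  shows "thin s e A"
proof -
  have "hausdorff_premeasure s \<delta> A < ennreal (e / 2)"
    using assms by simp
  then obtain U where U: "A \<subseteq> (\<Union>i. U i)" "\<And>i. bounded (U i)" "(\<Sum>i. diam_pow s (U i)) < ennreal (e / 2)"
    unfolding hausdorff_premeasure_def INF_less_iff by auto
  have "\<exists>V. open V \<and> bounded V \<and> U i \<subseteq> V \<and> diam_pow s V \<le> diam_pow s (U i) + ennreal (e / 2 * (1/2)^Suc i)" for i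
  proof -
    have "0 < e / 2 * (1/2)^Suc i" using assms(3) by simp
    from enlarge_to_open[OF U(2)[of i] assms(2) this] show ?thesis by metis
  qed
  then obtain V where V: "\<And>i. open (V i)" "\<And>i. bounded (V i)" "\<And>i. U i \<subseteq> V i"
      "\<And>i. diam_pow s (V i) \<le> diam_pow s (U i) + ennreal (e / 2 * (1/2)^Suc i)"
    by metis
  have geo: "(\<lambda>i. e / 2 * (1/2)^Suc i) sums (e / 2)"
    using sums_mult[OF power_half_series, of "e / 2"] by simp
  have "(\<Sum>i. diam_pow s (V i)) \<le> (\<Sum>i. diam_pow s (U i) + ennreal (e / 2 * (1/2)^Suc i))"
    by (intro suminf_le V) auto
  also have "\<dots> = (\<Sum>i. diam_pow s (U i)) + (\<Sum>i. ennreal (e / 2 * (1/2)^Suc i))"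
    by (intro suminf_add[symmetric]) auto
  also have "(\<Sum>i. ennreal (e / 2 * (1/2)^Suc i)) = ennreal (e / 2)"
    using geo assms(3) by (subst suminf_ennreal2) (auto simp: sums_iff simp del: power_Suc)
  also have "(\<Sum>i. diam_pow s (U i)) + ennreal (e / 2) < ennreal (e / 2) + ennreal (e / 2)"
    using U(3) by (simp add: ennreal_add_left_cancel_less add.commute)
  also have "\<dots> = ennreal e" using assms(3) by (simp flip: ennreal_plus)
  finally have "(\<Sum>i. diam_pow s (V i)) < ennreal e" .
  moreover have "A \<subseteq> (\<Union>i. V i)" by (rule order_trans[OF U(1) SUP_mono'[OF V(3)]])
  ultimately show ?thesis unfolding thin_def using V(1,2) by (intro exI[of _ V] conjI allI)
qed

lemma premeasure_antimono_exponent: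
  assumes "0 \<le> t" "t < s" "\<delta> \<le> 1"
  shows "hausdorff_premeasure s \<delta> A \<le> hausdorff_premeasure t \<delta> A"
  unfolding hausdorff_premeasure_def
proof (rule INF_mono, intro bexI)
  fix U :: "nat \<Rightarrow> 'a set"
  assume U: "U \<in> {U. A \<subseteq> (\<Union>i. U i) \<and> (\<forall>i. bounded (U i) \<and> diameter (U i) \<le> \<delta>)}"
  show "(\<Sum>i. diam_pow s (U i)) \<le> (\<Sum>i. diam_pow t (U i))"
  proof (intro suminf_le)
    fix i
    have d: "0 \<le> diameter (U i)" "diameter (U i) \<le> 1"
      using U assms(3) by (auto simp: diameter_ge_0 intro: order_trans)
    have "diameter (U i) powr s \<le> diameter (U i) powr t"
      using d assms by (intro powr_mono') auto
    moreover have "diameter (U i) powr s \<le> 1 powr s"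
      using d assms by (intro powr_mono2) auto
    ultimately show "diam_pow s (U i) \<le> diam_pow t (U i)"
      using assms by (auto simp: diam_pow_def ennreal_leI simp flip: ennreal_1 intro!: ennreal_leI)
  qed auto
qed

text \<open>
  If the sum of the powers is below \<open>\<delta> powr s\<close>, then each covering set has diameter at most \<open>\<delta>\<close>,
  so the cover is admissible for the premeasure at scale \<open>\<delta>\<close>.
\<close>
lemma thin_imp_hausdorff_null:
  assumes "\<And>e. 0 < e \<Longrightarrow> thin s e A" "0 < s"
  shows "hausdorff_measure s A = 0"
proof -
  have small: "hausdorff_premeasure s \<delta> A \<le> ennreal e" if "0 < \<delta>" "0 < e" for \<delta> e
  proof -
    define e' where "e' = min e (\<delta> powr s)"
    have "0 < e'" using that by (simp add: e'_def)
    then obtain U where U: "\<And>i. open (U i)" "\<And>i. bounded (U i)" "A \<subseteq> (\<Union>i. U i)" "(\<Sum>i. diam_pow s (U i)) < ennreal e'"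
      using assms(1) unfolding thin_def by metis
    have "diameter (U i) \<le> \<delta>" for i
    proof (rule ccontr)
      assume "\<not> diameter (U i) \<le> \<delta>"
      then have "\<delta> powr s \<le> diameter (U i) powr s"
        using that assms(2) by (intro powr_mono2) auto
      moreover have "U i \<noteq> {}" using \<open>\<not> diameter (U i) \<le> \<delta>\<close> that by auto
      ultimately have "ennreal e' \<le> diam_pow s (U i)"
        using assms(2) by (auto simp: diam_pow_def e'_def intro!: ennreal_leI)
      also have "\<dots> \<le> (\<Sum>i. diam_pow s (U i))"
        using sum_le_suminf[of "\<lambda>i. diam_pow s (U i)" "{i}"] by simp
      finally show False using U(4) by simp
    qed
    then have "hausdorff_premeasure s \<delta> A \<le> (\<Sum>i. diam_pow s (U i))"
      unfolding hausdorff_premeasure_def using U by (intro INF_lower) auto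
    also have "\<dots> \<le> ennreal e" 
      using U(4) by (rule order.strict_implies_order[THEN order_trans]) (simp add: e'_def ennreal_leI)
    finally show ?thesis .
  qed
  have "hausdorff_premeasure s \<delta> A \<le> 0" if "0 < \<delta>" for \<delta>
  proof (rule ennreal_le_epsilon)
    fix e :: real assume "0 < e"
    with small[OF that this] show "hausdorff_premeasure s \<delta> A \<le> 0 + ennreal e" by (simp only: add_0)
  qed
  then show ?thesis unfolding hausdorff_measure_def by (intro antisym SUP_least) auto
qed

lemma hausdorff_null_iff_thin:
  assumes "0 < s"
  shows "hausdorff_measure s A = 0 \<longleftrightarrow> (\<forall>e>0. thin s e A)"
proof
  assume "hausdorff_measure s A = 0"
  moreover have "hausdorff_premeasure s 1 A \<le> hausdorff_measure s A"
    unfolding hausdorff_measure_def by (rule SUP_upper) simp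
  ultimately show "\<forall>e>0. thin s e A"
    using premeasure_null_imp_thin[of s 1 A] assms by simp
qed (use thin_imp_hausdorff_null assms in blast)

lemma hausdorff_null_upward:
  assumes "hausdorff_measure t A = 0" "0 \<le> t" "t < s"
  shows "hausdorff_measure s A = 0"
proof -
  have "hausdorff_premeasure t 1 A \<le> hausdorff_measure t A"
    unfolding hausdorff_measure_def by (rule SUP_upper) simp
  then have "hausdorff_premeasure s 1 A = 0"
    using premeasure_antimono_exponent[of t s 1 A] assms by auto
  then show ?thesis
    using premeasure_null_imp_thin[of s 1 A] assms by (intro thin_imp_hausdorff_null) auto
qed

lemma hausdorff_dim_le: "hausdorff_measure s A = 0 \<Longrightarrow> 0 \<le> s \<Longrightarrow> hausdorff_dim A \<le> ennreal s"
  unfolding hausdorff_dim_def by (rule INF_lower) simp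

lemma hausdorff_dim_ge:
  assumes "hausdorff_measure s A \<noteq> 0"
  shows "ennreal s \<le> hausdorff_dim A"
  unfolding hausdorff_dim_def
proof (rule INF_greatest)
  fix t assume t: "t \<in> {t. 0 \<le> t \<and> hausdorff_measure t A = 0}"
  then have "s \<le> t" using hausdorff_null_upward[of t A s] assms by force
  then show "ennreal s \<le> ennreal t" by (rule ennreal_leI)
qed

lemma hausdorff_dim_empty: "hausdorff_dim ({} :: 'a::metric_space set) = 0"
proof -
  have "hausdorff_premeasure 0 \<delta> ({} :: 'a set) \<le> 0" if "\<delta> > 0" for \<delta>
    unfolding hausdorff_premeasure_def
    by (rule INF_lower2[of "\<lambda>_. {}"]) (use that in \<open>auto simp: diam_pow_def\<close>)
  then have "hausdorff_measure 0 ({} :: 'a set) = 0"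
    unfolding hausdorff_measure_def by (intro antisym SUP_least) auto
  from hausdorff_dim_le[OF this] show ?thesis by simp
qed

text \<open>
  Content scales with the power \<open>q powr s\<close> under a similarity of ratio \<open>q\<close>: preimages of a cover of
  the image form a cover with diameters divided by \<open>q\<close>.
\<close>
lemma thin_similarity:
  fixes \<psi> :: "'a::metric_space \<Rightarrow> 'a"
  assumes "thin s e (\<psi> ` A)" "similarity_with_ratio q \<psi>" "0 < q" "0 < s"
  shows "thin s (e / q powr s) A"
proof -
  have dist: "dist x y = dist (\<psi> x) (\<psi> y) / q" for x y
    using assms unfolding similarity_with_ratio_def by simp
  have cont: "continuous_on UNIV \<psi>"
    unfolding continuous_on_iff
  proof (intro ballI allI impI)
    fix x and e :: real assume "0 < e"
    then show "\<exists>d>0. \<forall>x'\<in>UNIV. dist x' x < d \<longrightarrow> dist (\<psi> x') (\<psi> x) < e"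
      using assms(3) by (intro exI[of _ "e / q"]) (simp add: dist[of _ x] divide_less_cancel)
  qed
  obtain U where U: "\<And>i. open (U i)" "\<And>i. bounded (U i)" "\<psi> ` A \<subseteq> (\<Union>i. U i)" "(\<Sum>i. diam_pow s (U i)) < ennreal e"
    using assms(1) unfolding thin_def by metis
  define V where "V i = \<psi> -` U i" for i
  have V_dist: "dist x y \<le> diameter (U i) / q" if "x \<in> V i" "y \<in> V i" for x y i
    using that U(2)[of i] assms(3) unfolding dist[of x y] V_def
    by (intro divide_right_mono diameter_bounded_bound) auto
  have "diam_pow s (V i) \<le> ennreal (1 / q powr s) * diam_pow s (U i)" for i
  proof (cases "V i = {}")
    case False
    then have ne: "U i \<noteq> {}" by (auto simp: V_def)
    have "diameter (V i) \<le> diameter (U i) / q"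
      using V_dist[of _ i] False by (intro diameter_le_metric) auto
    moreover have "bounded (V i)" using V_dist[of _ i] unfolding bounded_two_points by blast
    ultimately have "diameter (V i) powr s \<le> (diameter (U i) / q) powr s"
      using assms by (intro powr_mono2) (auto simp: diameter_ge_0)
    also have "\<dots> = 1 / q powr s * diameter (U i) powr s"
      using assms U(2)[of i] by (simp add: powr_divide diameter_ge_0)
    finally have "ennreal (diameter (V i) powr s) \<le> ennreal (1 / q powr s * diameter (U i) powr s)"
      by (rule ennreal_leI)
    also have "\<dots> = ennreal (1 / q powr s) * ennreal (diameter (U i) powr s)"
      by (rule ennreal_mult) auto
    finally show ?thesis using False ne assms(4) by (simp only: diam_pow_def if_False) simp
  qed (simp add: diam_pow_def)
  then have "(\<Sum>i. diam_pow s (V i)) \<le> (\<Sum>i. ennreal (1 / q powr s) * diam_pow s (U i))"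
    by (intro suminf_le) auto
  also have "\<dots> = ennreal (1 / q powr s) * (\<Sum>i. diam_pow s (U i))"
    by simp
  also have "\<dots> < ennreal (1 / q powr s) * ennreal e"
    using U(4) assms by (intro ennreal_mult_strict_left_mono) auto
  also have "\<dots> = ennreal (e / q powr s)"
    using assms by (simp flip: ennreal_mult')
  finally have "(\<Sum>i. diam_pow s (V i)) < ennreal (e / q powr s)" .
  moreover have "open (V i)" for i
    using cont U(1)[of i] unfolding V_def by (auto intro: open_vimage)
  moreover have "bounded (V i)" for i using V_dist[of _ i] unfolding bounded_two_points by blast
  moreover have "A \<subseteq> (\<Union>i. V i)" using U(3) unfolding V_def by blast
  ultimately show ?thesis unfolding thin_def by (intro exI[of _ V] conjI allI)
qed

section \<open>Extension, Lipschitz approximation and stability of level sets\<close>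

text \<open>
  A modulus of continuity of the form \<open>t * \<phi> t\<close> with decreasing \<open>\<phi>\<close> is subadditive, so that
  applying it to a metric again yields a metric. This is used for \<open>t powr \<alpha>\<close> and for its
  Lipschitz truncation \<open>min (t powr \<alpha>) (n * t)\<close>.
\<close>
lemma antitone_slope_subadditive:
  fixes \<phi> :: "real \<Rightarrow> real"
  assumes "\<And>s t. 0 < s \<Longrightarrow> s \<le> t \<Longrightarrow> \<phi> t \<le> \<phi> s" "0 \<le> a" "0 \<le> b"
  shows "(a + b) * \<phi> (a + b) \<le> a * \<phi> a + b * \<phi> b"
proof (cases "a = 0 \<or> b = 0")
  case False
  then have "a * \<phi> (a + b) \<le> a * \<phi> a" "b * \<phi> (a + b) \<le> b * \<phi> b"
    using assms by (auto intro!: mult_left_mono)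
  then show ?thesis by (simp add: distrib_right)
qed auto

lemma truncated_power_subadditive:
  fixes a b n \<alpha> :: real
  assumes "0 < \<alpha>" "\<alpha> < 1" "0 \<le> a" "0 \<le> b"
  shows "min ((a + b) powr \<alpha>) (n * (a + b)) \<le> min (a powr \<alpha>) (n * a) + min (b powr \<alpha>) (n * b)"
proof -
  have eq: "min (t powr \<alpha>) (n * t) = t * min (t powr (\<alpha> - 1)) n" if "0 \<le> t" for t :: real
  proof (cases "t = 0")
    case False
    then have "t powr \<alpha> = t * t powr (\<alpha> - 1)"
      using that by (simp add: powr_diff)
    then show ?thesis using that False by (simp add: min_mult_distrib_left mult.commute)
  qed simp
  have "min (t powr (\<alpha> - 1)) n \<le> min (s powr (\<alpha> - 1)) n" if "0 < s" "s \<le> t" for s t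
    using that assms by (intro min.mono powr_mono2') auto
  from antitone_slope_subadditive[of "\<lambda>t. min (t powr (\<alpha> - 1)) n", OF this assms(3,4)]
  show ?thesis using assms by (simp add: eq)
qed

lemma power_subadditive:
  fixes a b \<alpha> :: real
  assumes "0 < \<alpha>" "\<alpha> < 1" "0 \<le> a" "0 \<le> b"
  shows "(a + b) powr \<alpha> \<le> a powr \<alpha> + b powr \<alpha>"
proof -
  have eq: "t powr \<alpha> = t * t powr (\<alpha> - 1)" if "0 \<le> t" for t :: real
    using that by (cases "t = 0") (auto simp: powr_diff)
  have "t powr (\<alpha> - 1) \<le> s powr (\<alpha> - 1)" if "0 < s" "s \<le> t" for s t :: real
    using that assms by (intro powr_mono2') auto
  from antitone_slope_subadditive[of "\<lambda>t. t powr (\<alpha> - 1)", OF this assms(3,4)]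
  show ?thesis using assms by (simp add: eq[of a] eq[of b] eq[of "a + b"])
qed

lemma INF_le_INF_plus:
  fixes k l :: "'b \<Rightarrow> real"
  assumes "Y \<noteq> {}" "bdd_below (k ` Y)" "\<And>y. y \<in> Y \<Longrightarrow> k y \<le> l y + C"
  shows "(INF y\<in>Y. k y) \<le> (INF y\<in>Y. l y) + C"
proof -
  have "(INF y\<in>Y. k y) - C \<le> (INF y\<in>Y. l y)"
  proof (rule cINF_greatest[OF assms(1)])
    fix y assume "y \<in> Y"
    then have "(INF y\<in>Y. k y) \<le> k y" using assms(2) by (intro cINF_lower)
    then show "(INF y\<in>Y. k y) - C \<le> l y" using assms(3)[OF \<open>y \<in> Y\<close>] by linarith
  qed
  then show ?thesis by linarith
qed

context holder_functions
begin

lemma holder1D: "f \<in> X \<Longrightarrow> x \<in> F \<Longrightarrow> y \<in> F \<Longrightarrow> \<bar>f x - f y\<bar> \<le> dist x y powr \<alpha>"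
  by (simp add: holder1_def)

lemma restrict_holder1I:
  assumes "\<And>x y. x \<in> F \<Longrightarrow> y \<in> F \<Longrightarrow> g x \<le> g y + dist x y powr \<alpha>"
  shows "restrict g F \<in> X"
proof -
  have "\<bar>g x - g y\<bar> \<le> dist x y powr \<alpha>" if "x \<in> F" "y \<in> F" for x y
    using assms[OF that] assms[OF that(2) that(1)] by (simp add: dist_commute abs_le_iff)
  then show ?thesis by (simp add: holder1_def)
qed

lemma dist_powr_triangle: "dist x z powr \<alpha> \<le> dist x y powr \<alpha> + dist y z powr \<alpha>"
proof -
  have "dist x z powr \<alpha> \<le> (dist x y + dist y z) powr \<alpha>"
    using alpha_pos by (intro powr_mono2 dist_triangle) auto
  also have "\<dots> \<le> dist x y powr \<alpha> + dist y z powr \<alpha>"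
    using alpha_pos alpha_less_1 by (intro power_subadditive) auto
  finally show ?thesis .
qed

lemma holder1_continuous:
  assumes "f \<in> X"
  shows "continuous_on F f"
  unfolding continuous_on_iff
proof (intro ballI allI impI)
  fix x and e :: real assume x: "x \<in> F" and e: "0 < e"
  have "dist (f x') (f x) < e" if "x' \<in> F" "dist x' x < e powr (1 / \<alpha>)" for x'
  proof -
    have "dist (f x') (f x) \<le> dist x' x powr \<alpha>"
      using holder1D[OF assms that(1) x] by (simp add: dist_real_def)
    also have "\<dots> < (e powr (1 / \<alpha>)) powr \<alpha>"
      using that(2) alpha_pos by (intro powr_less_mono2) auto
    also have "\<dots> = e" using e alpha_pos by (simp add: powr_powr)
    finally show ?thesis .
  qed
  then show "\<exists>d>0. \<forall>x'\<in>F. dist x' x < d \<longrightarrow> dist (f x') (f x) < e"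
    using e by (intro exI[of _ "e powr (1 / \<alpha>)"]) auto
qed

lemma holder1_bounded:
  assumes "f \<in> X"
  obtains B where "0 < B" "\<And>x. x \<in> F \<Longrightarrow> \<bar>f x\<bar> \<le> B"
proof -
  have "bounded (f ` F)"
    using holder1_continuous[OF assms] compact_F by (intro compact_imp_bounded compact_continuous_image)
  then obtain B where "0 < B" "\<forall>y\<in>f ` F. norm y \<le> B" unfolding bounded_pos by blast
  then show ?thesis by (intro that[of B]) auto
qed

text \<open>
  The McShane extension of the values \<open>v i\<close> prescribed at the points \<open>p i\<close>, truncated from above at
  \<open>f + e\<close>. The truncation preserves the Hoelder condition and the prescribed values; the lower bound
  \<open>f - e\<close> is automatic, because \<open>v i \<ge> f (p i) - e\<close> and \<open>f\<close> is itself Hoelder. The points are indexed, so values need not be given as a function on a subset of \<open>F\<close>.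
\<close>
lemma holder_extension_near:
  fixes p :: "'i \<Rightarrow> 'a" and v :: "'i \<Rightarrow> real"
  assumes f: "f \<in> X" and p: "\<And>i. i \<in> I \<Longrightarrow> p i \<in> F" and e: "0 \<le> e"
    and v: "\<And>i j. i \<in> I \<Longrightarrow> j \<in> I \<Longrightarrow> v i \<le> v j + dist (p i) (p j) powr \<alpha>"
    and near: "\<And>i. i \<in> I \<Longrightarrow> \<bar>v i - f (p i)\<bar> \<le> e"
  obtains g where "g \<in> X" "\<And>i. i \<in> I \<Longrightarrow> g (p i) = v i" "close e f g"
proof (cases "I = {}")
  case True
  then show ?thesis using f e by (intro that[of f]) (auto simp: close_def)
next
  case False
  define m where "m x = (INF i\<in>I. v i + dist x (p i) powr \<alpha>)" for x
  have lower: "f x - e \<le> v i + dist x (p i) powr \<alpha>" if "x \<in> F" "i \<in> I" for x i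
    using holder1D[OF f that(1) p[OF that(2)]] near[OF that(2)] by (simp add: abs_le_iff)
  have bdd: "bdd_below ((\<lambda>i. v i + dist x (p i) powr \<alpha>) ` I)" if "x \<in> F" for x
    using lower[OF that] by (intro bdd_belowI2)
  have m_ge: "f x - e \<le> m x" if "x \<in> F" for x
    unfolding m_def using lower[OF that] False by (intro cINF_greatest)
  have m_eq: "m (p i) = v i" if i: "i \<in> I" for i
  proof (rule antisym)
    have "m (p i) \<le> v i + dist (p i) (p i) powr \<alpha>"
      unfolding m_def using bdd p i by (intro cINF_lower) auto
    then show "m (p i) \<le> v i" by simp
    show "v i \<le> m (p i)"
      unfolding m_def using False v[OF i] by (intro cINF_greatest)
  qed
  have m_holder: "m x \<le> m y + dist x y powr \<alpha>" if "x \<in> F" "y \<in> F" for x y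
    unfolding m_def
  proof (rule INF_le_INF_plus[OF False bdd[OF that(1)]])
    fix i
    show "v i + dist x (p i) powr \<alpha> \<le> v i + dist y (p i) powr \<alpha> + dist x y powr \<alpha>"
      using dist_powr_triangle[of x "p i" y] by simp
  qed
  let ?g = "\<lambda>x. min (f x + e) (m x)"
  have "restrict ?g F \<in> X"
  proof (rule restrict_holder1I)
    fix x y assume xy: "x \<in> F" "y \<in> F"
    show "?g x \<le> ?g y + dist x y powr \<alpha>"
      using holder1D[OF f xy] m_holder[OF xy] by (auto simp: min_def abs_le_iff)
  qed
  moreover have "restrict ?g F (p i) = v i" if "i \<in> I" for i
    using p[OF that] near[OF that] m_eq[OF that] by (auto simp: min_def abs_le_iff)
  moreover have "close e f (restrict ?g F)"
    unfolding close_def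
  proof
    fix x assume "x \<in> F"
    then show "\<bar>f x - restrict ?g F x\<bar> \<le> e" using m_ge[of x] e by (simp add: min_def abs_le_iff)
  qed
  ultimately show ?thesis by (intro that)
qed

text \<open>
  The approximation is the infimal convolution of \<open>f\<close> with the truncated modulus
  \<open>h t = min (t powr \<alpha>) (n * t)\<close>. It inherits both bounds in \<open>h\<close>, and it is close to \<open>f\<close> because
  \<open>t powr \<alpha> \<le> n * t + e / 2\<close> for large \<open>n\<close>. Multiplication by a constant \<open>c < 1\<close> near \<open>1\<close> leaves room
  in the Hoelder condition at large distances; the Lipschitz bound does so at small distances.
\<close>
lemma lipschitz_approximation:
  assumes f: "f \<in> X" and e: "0 < e"
  obtains g c n where "g \<in> X" "close e f g" "0 < c" "c < 1" "0 < n"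
    "\<And>x y. x \<in> F \<Longrightarrow> y \<in> F \<Longrightarrow> \<bar>g x - g y\<bar> \<le> c * dist x y powr \<alpha>"
    "\<And>x y. x \<in> F \<Longrightarrow> y \<in> F \<Longrightarrow> \<bar>g x - g y\<bar> \<le> n * dist x y"
proof -
  define t0 where "t0 = (e / 2) powr (1 / \<alpha>)"
  define n where "n = t0 powr (\<alpha> - 1)"
  have t0: "0 < t0" "t0 powr \<alpha> = e / 2" using e alpha_pos by (auto simp: t0_def powr_powr)
  have n: "0 < n" using t0 by (simp add: n_def)
  have pow_le: "t powr \<alpha> \<le> n * t + e / 2" if "0 \<le> t" for t
  proof (cases "t \<le> t0")
    case True
    then have "t powr \<alpha> \<le> t0 powr \<alpha>" using that alpha_pos by (intro powr_mono2) auto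
    then show ?thesis using t0 n that by (simp add: add_increasing)
  next
    case False
    then have "t powr \<alpha> = t powr (\<alpha> - 1) * t" using t0 by (simp add: powr_diff)
    also have "\<dots> \<le> n * t"
      unfolding n_def using False t0 alpha_less_1 that by (intro mult_right_mono powr_mono2') auto
    finally show ?thesis using e by simp
  qed
  define h where "h t = min (t powr \<alpha>) (n * t)" for t
  have h_mono: "h s \<le> h t" if "0 \<le> s" "s \<le> t" for s t
    unfolding h_def using that n alpha_pos by (intro min.mono powr_mono2 mult_left_mono) auto
  have h_tri: "h (dist x z) \<le> h (dist x y) + h (dist y z)" for x y z :: 'a
  proof -
    have "h (dist x z) \<le> h (dist x y + dist y z)" by (intro h_mono dist_triangle) auto
    also have "\<dots> \<le> h (dist x y) + h (dist y z)"
      unfolding h_def using alpha_pos alpha_less_1 by (intro truncated_power_subadditive) auto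
    finally show ?thesis .
  qed
  have lower: "f x - e / 2 \<le> f y + h (dist x y)" if "x \<in> F" "y \<in> F" for x y
    using holder1D[OF f that] pow_le[of "dist x y"] e by (auto simp: h_def min_def abs_le_iff)
  define g0 where "g0 x = (INF y\<in>F. f y + h (dist x y))" for x
  have bdd: "bdd_below ((\<lambda>y. f y + h (dist x y)) ` F)" if "x \<in> F" for x
    using lower[OF that] by (intro bdd_belowI2)
  have g0_ge: "f x - e / 2 \<le> g0 x" if "x \<in> F" for x
    unfolding g0_def using lower[OF that] F_nonempty by (intro cINF_greatest)
  have g0_le: "g0 x \<le> f x" if "x \<in> F" for x
  proof -
    have "g0 x \<le> f x + h (dist x x)" unfolding g0_def using bdd that by (intro cINF_lower) auto
    then show ?thesis by (simp add: h_def)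
  qed
  have g0_h: "g0 x \<le> g0 y + h (dist x y)" if "x \<in> F" "y \<in> F" for x y
    unfolding g0_def
  proof (rule INF_le_INF_plus[OF F_nonempty bdd[OF that(1)]])
    fix z
    show "f z + h (dist x z) \<le> f z + h (dist y z) + h (dist x y)"
      using h_tri[of x z y] by simp
  qed
  have g0_abs: "\<bar>g0 x - g0 y\<bar> \<le> h (dist x y)" if "x \<in> F" "y \<in> F" for x y
    using g0_h[OF that] g0_h[OF that(2,1)] by (simp add: dist_commute abs_le_iff)
  obtain B where B: "0 < B" "\<And>x. x \<in> F \<Longrightarrow> \<bar>f x\<bar> \<le> B" using holder1_bounded[OF f] by blast
  \<comment> \<open>The factor is chosen such that \<open>(1 - c) * (B + e) = e / 2\<close>, where \<open>B + e\<close> bounds \<open>g0\<close>.\<close>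
  define c where "c = 1 - e / (2 * (B + e))"
  have c: "0 < c" "c < 1" using B e by (auto simp: c_def field_simps)
  let ?g = "restrict (\<lambda>x. c * g0 x) F"
  have g_abs: "\<bar>?g x - ?g y\<bar> \<le> c * h (dist x y)" if "x \<in> F" "y \<in> F" for x y
  proof -
    have "\<bar>?g x - ?g y\<bar> = c * \<bar>g0 x - g0 y\<bar>"
      using that c by (simp add: abs_mult flip: right_diff_distrib)
    then show ?thesis using g0_abs[OF that] c by simp
  qed
  have h_le: "h (dist x y) \<le> dist x y powr \<alpha>" "h (dist x y) \<le> n * dist x y" for x y :: 'a
    by (auto simp: h_def)
  have g_alpha: "\<bar>?g x - ?g y\<bar> \<le> c * dist x y powr \<alpha>" if "x \<in> F" "y \<in> F" for x y
    using g_abs[OF that] mult_left_mono[OF h_le(1)[of x y], of c] c by linarith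
  have h_nonneg: "0 \<le> h (dist x y)" for x y :: 'a using n by (simp add: h_def)
  have g_lip: "\<bar>?g x - ?g y\<bar> \<le> n * dist x y" if "x \<in> F" "y \<in> F" for x y
    using g_abs[OF that] h_le(2)[of x y] mult_left_le_one_le[of "h (dist x y)" c] h_nonneg[of x y] c
    by linarith
  have "?g \<in> X"
    unfolding holder1_def
  proof (intro CollectI conjI ballI)
    fix x y assume "x \<in> F" "y \<in> F"
    then show "\<bar>?g x - ?g y\<bar> \<le> dist x y powr \<alpha>"
      using g_alpha[of x y] mult_left_le_one_le[of "dist x y powr \<alpha>" c] c by simp
  qed simp
  moreover have "close e f ?g"
    unfolding close_def
  proof
    fix x assume x: "x \<in> F"
    have "\<bar>g0 x\<bar> \<le> B + e" using g0_ge[OF x] g0_le[OF x] B(2)[OF x] e by linarith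
    then have "(1 - c) * \<bar>g0 x\<bar> \<le> e / (2 * (B + e)) * (B + e)"
      using e B(1) by (intro mult_mono) (auto simp: c_def)
    also have "\<dots> = e / 2" using e B(1) by (simp add: field_simps)
    finally have "(1 - c) * \<bar>g0 x\<bar> \<le> e / 2" .
    moreover have "\<bar>g0 x - c * g0 x\<bar> = \<bar>(1 - c) * g0 x\<bar>" by (simp add: left_diff_distrib)
    ultimately have "\<bar>g0 x - c * g0 x\<bar> \<le> e / 2" using c by (simp add: abs_mult)
    moreover have "?g x = c * g0 x" using x by simp
    ultimately show "\<bar>f x - ?g x\<bar> \<le> e" using g0_ge[OF x] g0_le[OF x] by linarith
  qed
  ultimately show ?thesis using c n g_alpha g_lip by (intro that[of ?g c n])
qed

abbreviation level :: "('a \<Rightarrow> real) \<Rightarrow> real \<Rightarrow> 'a set" where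
  "level f r \<equiv> {x \<in> F. f x = r}"

text \<open>
  On the compact set \<open>F - V\<close> the distance of \<open>f\<close> from the value \<open>r\<close> has a positive minimum.
\<close>
lemma level_near_subset_open:
  assumes f: "f \<in> X" and V: "open V" "level f r \<subseteq> V"
  obtains d where "0 < d" "\<And>g r'. close d f g \<Longrightarrow> \<bar>r' - r\<bar> \<le> d \<Longrightarrow> level g r' \<subseteq> V"
proof (cases "F - V = {}")
  case True
  then show ?thesis by (intro that[of 1]) auto
next
  case False
  have "compact (F - V)" using compact_F V(1) by (rule compact_diff)
  moreover have "continuous_on (F - V) (\<lambda>x. \<bar>f x - r\<bar>)"
    using holder1_continuous[OF f] by (auto intro!: continuous_intros elim: continuous_on_subset)
  ultimately obtain a where a: "a \<in> F - V" "\<And>x. x \<in> F - V \<Longrightarrow> \<bar>f a - r\<bar> \<le> \<bar>f x - r\<bar>"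
    using continuous_attains_inf[of "F - V" "\<lambda>x. \<bar>f x - r\<bar>"] False by blast
  define M where "M = \<bar>f a - r\<bar>"
  have pos: "0 < M" using a V by (auto simp: M_def)
  show ?thesis
  proof (rule that[of "M / 3"])
    show "0 < M / 3" using pos by simp
    fix g r' assume g: "close (M / 3) f g" and r': "\<bar>r' - r\<bar> \<le> M / 3"
    show "level g r' \<subseteq> V"
    proof (rule ccontr)
      assume "\<not> level g r' \<subseteq> V"
      then obtain x where x: "x \<in> F - V" "g x = r'" by auto
      then have "\<bar>f x - g x\<bar> \<le> M / 3" using g by (auto simp: close_def)
      with a(2)[OF x(1), folded M_def] x(2) r' pos show False by linarith
    qed
  qed
qed

lemma thin_level_stable:
  assumes "f \<in> X" "thin s e (level f r)"
  obtains d where "0 < d" "\<And>g r'. close d f g \<Longrightarrow> \<bar>r' - r\<bar> \<le> d \<Longrightarrow> thin s e (level g r')"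
proof -
  obtain V where V: "open V" "level f r \<subseteq> V" "\<And>B. B \<subseteq> V \<Longrightarrow> thin s e B"
    using thin_neighbourhood[OF assms(2)] by metis
  obtain d where d: "0 < d" "\<And>g r'. close d f g \<Longrightarrow> \<bar>r' - r\<bar> \<le> d \<Longrightarrow> level g r' \<subseteq> V"
    using level_near_subset_open[OF assms(1) V(1,2)] by metis
  show ?thesis by (rule that[OF d(1)]) (rule V(3)[OF d(2)])
qed

text \<open>The values at which the level set has content at least \<open>e\<close>.\<close>
definition fat :: "real \<Rightarrow> real \<Rightarrow> ('a \<Rightarrow> real) \<Rightarrow> real set" where
  "fat s e f = {r. \<not> thin s e (level f r)}"

lemma close_mono: "close d f g \<Longrightarrow> d \<le> d' \<Longrightarrow> close d' f g"
  by (auto simp: close_def intro: order_trans)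

lemma fat_antimono: "e \<le> e' \<Longrightarrow> fat s e' f \<subseteq> fat s e f"
  unfolding fat_def using thin_mono by blast

lemma fat_subset_image: "0 < e \<Longrightarrow> fat s e f \<subseteq> f ` F"
proof
  fix r assume "0 < e" "r \<in> fat s e f"
  then have "level f r \<noteq> {}" using thin_empty[of e s] unfolding fat_def by (metis mem_Collect_eq)
  then show "r \<in> f ` F" by auto
qed

lemma closed_fat:
  assumes "f \<in> X"
  shows "closed (fat s e f)"
proof -
  have "open (- fat s e f)"
    unfolding open_dist
  proof
    fix r assume "r \<in> - fat s e f"
    then obtain d where "0 < d" "\<And>g r'. close d f g \<Longrightarrow> \<bar>r' - r\<bar> \<le> d \<Longrightarrow> thin s e (level g r')"
      using thin_level_stable[OF assms, of s e r] by (auto simp: fat_def)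
    moreover from this have "close d f f" by (simp add: close_def)
    ultimately show "\<exists>e'>0. \<forall>y. dist y r < e' \<longrightarrow> y \<in> - fat s e f"
      by (intro exI[of _ d]) (auto simp: fat_def dist_real_def)
  qed
  then show ?thesis by (simp add: closed_def)
qed

text \<open>
  Cover the fat values by an open set \<open>W\<close> of measure less than \<open>c\<close>. The values outside \<open>W\<close> that
  functions close to \<open>f\<close> can attain form a compact set of thin values, and thinness is stable, uniformly
  on this compact set. So the fat values of a nearby function all lie in \<open>W\<close>.
\<close>
lemma measure_fat_upper_semicontinuous:
  assumes f: "f \<in> X" and e: "0 < e" and less: "emeasure lborel (fat s e f) < ennreal c"
  obtains d where "0 < d" "\<And>g. g \<in> X \<Longrightarrow> close d f g \<Longrightarrow> emeasure lborel (fat s e g) < ennreal c"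
proof -
  have meas: "fat s e f \<in> sets borel" using closed_fat[OF f] by (rule borel_closed)
  have fin: "emeasure lborel (fat s e f) \<noteq> \<infinity>" using less by auto
  define b where "b = enn2real (emeasure lborel (fat s e f))"
  have b: "emeasure lborel (fat s e f) = ennreal b" "0 \<le> b"
    using fin by (auto simp: b_def less_top)
  have "b < c" using less b by (simp add: ennreal_less_iff)
  then obtain W where W: "open W" "fat s e f \<subseteq> W" "emeasure lborel (W - fat s e f) < ennreal (c - b)"
    using outer_regular_lborel[OF meas, of "c - b"] by auto
  have "emeasure lborel W = emeasure lborel (fat s e f) + emeasure lborel (W - fat s e f)"
    using W meas by (subst plus_emeasure) (auto simp: Un_absorb1 Un_Diff_cancel intro!: arg_cong[where f = "emeasure lborel"])
  also have "\<dots> < ennreal b + ennreal (c - b)"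
    unfolding b using W(3) by (simp add: ennreal_add_left_cancel_less)
  also have "\<dots> = ennreal c" using b(2) \<open>b < c\<close> by (simp flip: ennreal_plus)
  finally have W_less: "emeasure lborel W < ennreal c" .
  obtain B where B: "0 < B" "\<And>x. x \<in> F \<Longrightarrow> \<bar>f x\<bar> \<le> B" using holder1_bounded[OF f] by blast
  define K where "K = {- B - 1..B + 1} - W"
  have K: "compact K" unfolding K_def using W(1) by (intro compact_diff compact_Icc)
  have "\<exists>d>0. \<forall>g r'. close d f g \<longrightarrow> \<bar>r' - r\<bar> \<le> d \<longrightarrow> thin s e (level g r')" if "r \<in> K" for r
  proof -
    have "thin s e (level f r)" using that W(2) unfolding K_def fat_def by blast
    from thin_level_stable[OF f this] show ?thesis by metis
  qed
  then obtain d where d: "\<And>r. r \<in> K \<Longrightarrow> 0 < d r"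
      "\<And>r g r'. r \<in> K \<Longrightarrow> close (d r) f g \<Longrightarrow> \<bar>r' - r\<bar> \<le> d r \<Longrightarrow> thin s e (level g r')"
    by metis
  have "K \<subseteq> (\<Union>r\<in>K. ball r (d r))" using d(1) by fastforce
  then obtain C where C: "C \<subseteq> K" "finite C" "K \<subseteq> (\<Union>r\<in>C. ball r (d r))"
    using compactE_image[OF K, of K "\<lambda>r. ball r (d r)"] by auto
  define D where "D = Min (insert 1 (d ` C))"
  have D: "0 < D" "D \<le> 1" "\<And>r. r \<in> C \<Longrightarrow> D \<le> d r"
    unfolding D_def using C d(1) by (auto simp: Min_gr_iff)
  show ?thesis
  proof (rule that[OF D(1)])
    fix g assume g: "g \<in> X" "close D f g"
    have "fat s e g \<subseteq> W"
    proof
      fix r assume r: "r \<in> fat s e g"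
      then obtain x where x: "x \<in> F" "r = g x" using fat_subset_image[OF e, of s g] by auto
      then have "\<bar>r\<bar> \<le> B + 1" using g(2) B(2)[OF x(1)] D(2) unfolding close_def by force
      show "r \<in> W"
      proof (rule ccontr)
        assume "r \<notin> W"
        then have "r \<in> K" using \<open>\<bar>r\<bar> \<le> B + 1\<close> by (auto simp: K_def)
        then obtain r0 where r0: "r0 \<in> C" "dist r0 r < d r0" using C(3) by auto
        then have "thin s e (level g r)"
          using C(1) close_mono[OF g(2) D(3)[OF r0(1)]] by (intro d(2)[of r0]) (auto simp: dist_real_def)
        then show False using r by (simp add: fat_def)
      qed
    qed
    then have "emeasure lborel (fat s e g) \<le> emeasure lborel W"
      using W(1) by (intro emeasure_mono) auto
    then show "emeasure lborel (fat s e g) < ennreal c" using W_less by (rule le_less_trans)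
  qed
qed

end

section \<open>Inserting small copies of a function\<close>

lemma emeasure_affine_vimage:
  fixes A :: "real set"
  assumes [measurable]: "A \<in> sets borel" and c: "0 < c"
  shows "emeasure lborel {r. (r - t) / c \<in> A} = ennreal c * emeasure lborel A"
proof -
  let ?B = "{r. (r - t) / c \<in> A}"
  have "(\<lambda>r. (r - t) / c) -` A \<inter> space borel \<in> sets borel"
    by (rule measurable_sets[where A = borel]) auto
  then have [measurable]: "?B \<in> sets borel" by (simp add: vimage_def)
  have "emeasure lborel ?B = (\<integral>\<^sup>+r. indicator ?B r \<partial>lborel)" by simp
  also have "\<dots> = \<bar>c\<bar> * (\<integral>\<^sup>+r. indicator ?B (t + c * r) \<partial>lborel)"
    using c by (intro nn_integral_real_affine) auto
  also have "(\<lambda>r. indicator ?B (t + c * r) :: ennreal) = indicator A"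
    using c by (auto simp: indicator_def fun_eq_iff)
  finally show ?thesis using c by simp
qed

text \<open>
  The explicit form in which \<open>\<alpha> < 1\<close> enters, with \<open>\<beta> = 1 / \<alpha>\<close>: at small scales, \<open>w powr \<beta>\<close> is
  negligible against \<open>w\<close>.
\<close>
lemma superlinear_power_dominated:
  fixes \<beta> K :: real
  assumes "1 < \<beta>" "0 < K"
  obtains w0 where "0 < w0" "\<And>w. 0 \<le> w \<Longrightarrow> w \<le> w0 \<Longrightarrow> w powr \<beta> \<le> K * w"
proof (rule that[of "K powr (1 / (\<beta> - 1))"])
  show "0 < K powr (1 / (\<beta> - 1))" using assms by simp
  fix w assume w: "0 \<le> w" "w \<le> K powr (1 / (\<beta> - 1))"
  show "w powr \<beta> \<le> K * w"
  proof (cases "w = 0")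
    case False
    have "w powr (\<beta> - 1) \<le> (K powr (1 / (\<beta> - 1))) powr (\<beta> - 1)"
      using w assms by (intro powr_mono2) auto
    also have "\<dots> = K" using assms by (simp add: powr_powr)
    finally have "w powr (\<beta> - 1) * w \<le> K * w" using w(1) by (rule mult_right_mono)
    moreover have "w powr (\<beta> - 1) * w = w powr \<beta>" using w(1) False by (simp add: powr_diff)
    ultimately show ?thesis by simp
  qed simp
qed

context holder_functions
begin

definition non_null :: "real \<Rightarrow> ('a \<Rightarrow> real) \<Rightarrow> real set" where
  "non_null s f = {r. hausdorff_measure s (level f r) \<noteq> 0}"

lemma non_null_eq_Union_fat:
  assumes "0 < s"
  shows "non_null s f = (\<Union>n. fat s (1 / real (Suc n)) f)"
proof -
  have "(\<forall>e>0. thin s e A) \<longleftrightarrow> (\<forall>n. thin s (1 / real (Suc n)) A)" for A :: "'a set"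
  proof
    assume *: "\<forall>n. thin s (1 / real (Suc n)) A"
    show "\<forall>e>0. thin s e A"
    proof (intro allI impI)
      fix e :: real assume "0 < e"
      then obtain n where "1 / real (Suc n) < e" using nat_approx_posE by blast
      then show "thin s e A" using * thin_mono[of s "1 / real (Suc n)" A A e] by simp
    qed
  qed simp
  then show ?thesis
    unfolding non_null_def fat_def hausdorff_null_iff_thin[OF assms] by blast
qed

lemma fat_subset_non_null: "0 < s \<Longrightarrow> 0 < e \<Longrightarrow> fat s e f \<subseteq> non_null s f"
  unfolding non_null_def fat_def using hausdorff_null_iff_thin by blast

lemma non_null_borel: "f \<in> X \<Longrightarrow> 0 < s \<Longrightarrow> non_null s f \<in> sets borel"
  unfolding non_null_eq_Union_fat using closed_fat by (intro sets.countable_UN) auto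

lemma close_triangle: "close d f g \<Longrightarrow> close d' g h \<Longrightarrow> close (d + d') f h"
  unfolding close_def by (smt (verit))

text \<open>
  The functions \<open>g\<close> having a whole ball on which \<open>P\<close> holds form an open set; the assumption says that it
  is dense.
\<close>
lemma generic_if_densely_stable:
  assumes "\<And>f e. f \<in> X \<Longrightarrow> 0 < e \<Longrightarrow> \<exists>g\<in>X. close e f g \<and> (\<exists>d>0. \<forall>h\<in>X. close d g h \<longrightarrow> P h)"
  shows "generic {f. P f}"
proof -
  define U where "U = {g \<in> X. \<exists>d>0. \<forall>h\<in>X. close d g h \<longrightarrow> P h}"
  have "openin XT U"
    unfolding openin_iff
  proof (intro conjI ballI)
    fix g assume "g \<in> U"
    then obtain d where d: "0 < d" "\<forall>h\<in>X. close d g h \<longrightarrow> P h" by (auto simp: U_def)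
    have "g' \<in> U" if "g' \<in> X" "close (d / 2) g g'" for g'
    proof -
      have "P h" if "h \<in> X" "close (d / 2) g' h" for h
        using close_triangle[OF \<open>close (d / 2) g g'\<close> that(2)] d(2) that(1) by simp
      then show ?thesis using that d(1) unfolding U_def by (intro CollectI conjI exI[of _ "d / 2"]) auto
    qed
    then show "\<exists>e>0. \<forall>g'\<in>X. close e g g' \<longrightarrow> g' \<in> U" using d(1) by (intro exI[of _ "d / 2"]) auto
  qed (auto simp: U_def)
  moreover have "XT closure_of U = X"
    unfolding dense_iff using assms by (force simp: U_def)
  ultimately have "generic U"
    by (intro open_dense_imp_generic) (simp add: open_dense_def)
  moreover have "close d f f" if "0 < d" for d f using that by (simp add: close_def)
  then have "X \<inter> U \<subseteq> {f. P f}" unfolding U_def by blast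
  ultimately show ?thesis by (rule generic_mono)
qed

text \<open>
  The function \<open>g\<close> seen on the copy \<open>\<psi> ` F\<close>, with the value \<open>t\<close> moved to \<open>0\<close> and heights divided
  by \<open>q powr \<alpha>\<close>, which is the normalisation that keeps the Hoelder constant \<open>1\<close>.
\<close>
definition rescale :: "('a \<Rightarrow> 'a) \<Rightarrow> real \<Rightarrow> real \<Rightarrow> ('a \<Rightarrow> real) \<Rightarrow> 'a \<Rightarrow> real" where
  "rescale \<psi> q t g = (\<lambda>x\<in>F. (g (\<psi> x) - t) / q powr \<alpha>)"

lemma rescale_holder1:
  assumes "g \<in> X" "similarity_with_ratio q \<psi>" "0 < q" "\<psi> ` F \<subseteq> F"
  shows "rescale \<psi> q t g \<in> X"
  unfolding rescale_def
proof (rule restrict_holder1I)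
  fix x y assume xy: "x \<in> F" "y \<in> F"
  have "g (\<psi> x) - g (\<psi> y) \<le> dist (\<psi> x) (\<psi> y) powr \<alpha>"
    using holder1D[OF assms(1), of "\<psi> x" "\<psi> y"] xy assms(4) by (auto simp: abs_le_iff)
  also have "\<dots> = q powr \<alpha> * dist x y powr \<alpha>"
    using assms by (simp add: similarity_with_ratio_def powr_mult)
  finally show "(g (\<psi> x) - t) / q powr \<alpha> \<le> (g (\<psi> y) - t) / q powr \<alpha> + dist x y powr \<alpha>"
    using assms(3) by (simp add: field_simps)
qed

lemma fat_rescale:
  assumes "similarity_with_ratio q \<psi>" "0 < q" "\<psi> ` F \<subseteq> F" "0 < s"
  shows "{r. (r - t) / q powr \<alpha> \<in> fat s e (rescale \<psi> q t g)} \<subseteq> fat s (e * q powr s) g"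
proof
  fix r assume "r \<in> {r. (r - t) / q powr \<alpha> \<in> fat s e (rescale \<psi> q t g)}"
  then have not_thin: "\<not> thin s e (level (rescale \<psi> q t g) ((r - t) / q powr \<alpha>))"
    by (simp add: fat_def)
  have "\<psi> ` level (rescale \<psi> q t g) ((r - t) / q powr \<alpha>) \<subseteq> level g r"
    using assms by (auto simp: rescale_def field_simps)
  then show "r \<in> fat s (e * q powr s) g"
    using not_thin thin_mono[of s "e * q powr s" "level g r"]
      thin_similarity[OF _ assms(1,2,4), of "e * q powr s"] assms(2)
    unfolding fat_def by force
qed

end

text \<open>
  The only consequence of self-similarity that is used: up to the factor \<open>q0\<close>, every point lies in a
  similar copy of \<open>F\<close> of any prescribed size up to \<open>1\<close>.
\<close>
locale holder_functions_with_copies = holder_functions F \<alpha> for F :: "'a::metric_space set" and \<alpha> +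
  fixes q0 :: real
  assumes connected_F: "connected F" and q0: "0 < q0"
    and copies: "\<And>x \<rho>. x \<in> F \<Longrightarrow> 0 < \<rho> \<Longrightarrow> \<rho> \<le> 1 \<Longrightarrow>
      \<exists>\<psi> q. q0 * \<rho> \<le> q \<and> q \<le> \<rho> \<and> similarity_with_ratio q \<psi> \<and> \<psi> ` F \<subseteq> F \<and> x \<in> \<psi> ` F"
begin

text \<open>
  The key construction. With \<open>k\<close> equally spaced values at distance \<open>\<sigma> = (b - a) / k\<close>, copies of size
  \<open>\<rho>\<close> are used, where \<open>\<rho> powr \<alpha> = w = \<sigma> / (4 * M)\<close>. As \<open>\<bar>f1\<bar> \<le> M\<close>, the oscillation on a copy is
  comparable to the spacing, but the ranges on different copies stay disjoint. Each copy contributes fat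
  values of measure at least \<open>(q0 * \<rho>) powr \<alpha> * \<eta>\<close>, a fixed multiple of \<open>\<sigma>\<close>, so the total is a fixed
  multiple of \<open>b - a\<close>.

  It has to be checked that the prescribed values satisfy the Hoelder condition for points in different
  copies. The points \<open>x i\<close> have distance at least \<open>\<sigma> / n\<close> by the Lipschitz bound, whereas
  \<open>\<rho>\<close> is of order \<open>\<sigma> powr (1 / \<alpha>)\<close>. So, for small \<open>\<sigma>\<close>, passing from \<open>x i\<close> to other points of
  the copies changes distances only by a factor close to \<open>1\<close>.
\<close>
lemma insert_copies:
  assumes f1: "f1 \<in> X" and s: "0 < s" and \<eta>: "0 < \<eta>"
    and M: "0 < M" "\<And>x. x \<in> F \<Longrightarrow> \<bar>f1 x\<bar> + e1 \<le> M" and e1: "0 < e1"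
    and fat_large: "\<And>f. f \<in> X \<Longrightarrow> close e1 f1 f \<Longrightarrow> ennreal \<eta> \<le> emeasure lborel (fat s \<eta> f)"
    and f2: "f2 \<in> X" "0 < c" "c < 1" "0 < n"
      "\<And>x y. x \<in> F \<Longrightarrow> y \<in> F \<Longrightarrow> \<bar>f2 x - f2 y\<bar> \<le> c * dist x y powr \<alpha>"
      "\<And>x y. x \<in> F \<Longrightarrow> y \<in> F \<Longrightarrow> \<bar>f2 x - f2 y\<bar> \<le> n * dist x y"
    and ab: "a < b" "{a..b} \<subseteq> f2 ` F" and e: "0 < e"
  obtains g d where "g \<in> X" "close e f2 g" "0 < d"
    "\<And>h. h \<in> X \<Longrightarrow> close d g h \<Longrightarrow>
       ennreal (q0 powr \<alpha> * \<eta> / (4 * M) * (b - a)) \<le> emeasure lborel (non_null s h \<inter> {a<..<b})"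
proof -
  define L where "L = b - a"
  have L: "0 < L" using ab by (simp add: L_def)
  \<comment> \<open>Half of the room in the Hoelder condition pays for the change of distances, half for the change
    of values.\<close>
  define \<tau> where "\<tau> = (1 - c) / 2"
  have \<tau>: "0 < \<tau>" "\<tau> < 1" "c + \<tau> = 1 - \<tau>" using f2(2,3) by (auto simp: \<tau>_def field_simps)
  obtain \<Delta> where \<Delta>: "0 < \<Delta>" "\<And>x y. x \<in> F \<Longrightarrow> y \<in> F \<Longrightarrow> dist x y \<le> \<Delta>"
  proof -
    obtain C where C: "\<forall>x\<in>F. \<forall>y\<in>F. dist x y \<le> C"
      using compact_imp_bounded[OF compact_F] unfolding bounded_two_points by blast
    show ?thesis by (rule that[of "\<bar>C\<bar> + 1"]) (use C in fastforce)+
  qed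
  have beta: "1 < 1 / \<alpha>" using alpha_pos alpha_less_1 by simp
  obtain w1 where w1: "0 < w1" "\<And>w. 0 \<le> w \<Longrightarrow> w \<le> w1 \<Longrightarrow> w powr (1 / \<alpha>) \<le> (2 * \<tau> * M / (n * \<Delta>)) * w"
    using superlinear_power_dominated[OF beta, of "2 * \<tau> * M / (n * \<Delta>)"] \<tau> M(1) f2(4) \<Delta>(1) by auto
  obtain w2 where w2: "0 < w2" "\<And>w. 0 \<le> w \<Longrightarrow> w \<le> w2 \<Longrightarrow> w powr (1 / \<alpha>) \<le> ((1 - \<tau>) / (3 / 2 * n)) * w"
    using superlinear_power_dominated[OF beta, of "(1 - \<tau>) / (3 / 2 * n)"] \<tau> f2(4) by auto
  \<comment> \<open>The four bounds on \<open>w\<close> give, in this order: copies are not larger than \<open>F\<close>, the change of \<open>f2\<close> is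
    at most \<open>e\<close>, copies are small compared with their distances, and the change of values is absorbed at
    large distances.\<close>
  define w0 where "w0 = Min {1, e / (M + \<Delta> powr \<alpha>), w1, \<tau> * w2 / (2 * M)}"
  have w0: "0 < w0"
    unfolding w0_def using e M(1) w1(1) w2(1) \<tau>(1) by (auto simp: add_pos_nonneg)
  obtain k0 :: nat where k0: "L / (4 * M * w0) < real k0" using reals_Archimedean2 by blast
  define k where "k = Suc k0"
  have k: "0 < real k" "L / (4 * M * w0) < real k" using k0 by (auto simp: k_def)
  define \<sigma> where "\<sigma> = L / real k"
  have \<sigma>: "0 < \<sigma>" "real k * \<sigma> = L" using L k by (auto simp: \<sigma>_def)
  define w where "w = \<sigma> / (4 * M)"
  have w: "0 < w" "w * M = \<sigma> / 4" using \<sigma> M(1) by (auto simp: w_def)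
  have "w \<le> w0"
    using k M(1) w0 unfolding w_def \<sigma>_def by (simp add: field_simps)
  then have w_small: "w \<le> 1" "w \<le> e / (M + \<Delta> powr \<alpha>)" "w \<le> w1" "w \<le> \<tau> * w2 / (2 * M)"
    unfolding w0_def by auto
  define \<rho> where "\<rho> = w powr (1 / \<alpha>)"
  have \<rho>_powr: "\<rho> powr \<alpha> = w" using w(1) alpha_pos by (simp add: \<rho>_def powr_powr)
  have \<rho>: "0 < \<rho>" "\<rho> \<le> 1"
    using w(1) w_small(1) alpha_pos by (auto simp: \<rho>_def intro: powr_le1)
  \<comment> \<open>The left hand side bounds the change of the distance between two copies.\<close>
  have sep_small: "2 * \<rho> * \<Delta> \<le> \<tau> * (\<sigma> / n)"
  proof -
    have "\<rho> \<le> (2 * \<tau> * M / (n * \<Delta>)) * w" unfolding \<rho>_def using w1(2) w(1) w_small(3) by simp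
    then have "2 * \<rho> * \<Delta> \<le> 2 * ((2 * \<tau> * M / (n * \<Delta>)) * w) * \<Delta>"
      using \<Delta>(1) by (intro mult_right_mono mult_left_mono) auto
    also have "\<dots> = \<tau> * (4 * (w * M) / n)" using \<Delta>(1) by (simp add: field_simps)
    finally show ?thesis using w(2) by simp
  qed
  have near_small: "w * M + w * \<Delta> powr \<alpha> \<le> e"
    using w_small(2) M(1) by (simp add: pos_le_divide_eq add_pos_nonneg distrib_left)
  have gap_small: "\<sigma> / 2 \<le> \<tau> * w2"
  proof -
    have "2 * (w * M) \<le> \<tau> * w2" using w_small(4) M(1) by (simp add: field_simps)
    then show ?thesis using w(2) by simp
  qed

  \<comment> \<open>The midpoints of the \<open>k\<close> subintervals of length \<open>\<sigma>\<close>.\<close>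
  define r where "r i = a + (real i + 1 / 2) * \<sigma>" for i :: nat
  have r_in: "a + \<sigma> / 2 \<le> r i" "r i \<le> b - \<sigma> / 2" if "i < k" for i
  proof -
    have "(real i + 1) * \<sigma> \<le> real k * \<sigma>" using that \<sigma>(1) by (intro mult_right_mono) auto
    then show "a + \<sigma> / 2 \<le> r i" "r i \<le> b - \<sigma> / 2"
      using \<sigma> by (auto simp: r_def L_def field_simps)
  qed
  have r_sep: "\<sigma> \<le> \<bar>r i - r j\<bar>" if "i \<noteq> j" for i j
  proof -
    have "r i - r j = (real i - real j) * \<sigma>" by (simp add: r_def algebra_simps)
    then have "\<bar>r i - r j\<bar> = \<bar>real i - real j\<bar> * \<sigma>" using \<sigma>(1) by (simp add: abs_mult)
    moreover have "1 \<le> \<bar>real i - real j\<bar>" using that by linarith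
    ultimately show ?thesis using \<sigma>(1) by simp
  qed
  have "\<exists>x. x \<in> F \<and> f2 x = r i" if "i < k" for i
  proof -
    have "r i \<in> {a..b}" using r_in[OF that] \<sigma>(1) by auto
    then show ?thesis using ab(2) by (metis imageE subsetD)
  qed
  then obtain x where x: "\<And>i. i < k \<Longrightarrow> x i \<in> F" "\<And>i. i < k \<Longrightarrow> f2 (x i) = r i" by metis
  have "\<exists>\<psi> q. q0 * \<rho> \<le> q \<and> q \<le> \<rho> \<and> similarity_with_ratio q \<psi> \<and> \<psi> ` F \<subseteq> F \<and> x i \<in> \<psi> ` F" if "i < k" for i
    using copies[OF x(1)[OF that] \<rho>] .
  then obtain \<psi> q where "\<And>i. i < k \<Longrightarrow> q0 * \<rho> \<le> q i \<and> q i \<le> \<rho> \<and> similarity_with_ratio (q i) (\<psi> i) \<and>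
      \<psi> i ` F \<subseteq> F \<and> x i \<in> \<psi> i ` F"
    by metis
  then have q: "\<And>i. i < k \<Longrightarrow> q0 * \<rho> \<le> q i" "\<And>i. i < k \<Longrightarrow> q i \<le> \<rho>"
    and sim: "\<And>i. i < k \<Longrightarrow> similarity_with_ratio (q i) (\<psi> i)"
    and \<psi>F: "\<And>i. i < k \<Longrightarrow> \<psi> i ` F \<subseteq> F" and x\<psi>: "\<And>i. i < k \<Longrightarrow> x i \<in> \<psi> i ` F"
    by blast+
  have q_pos: "0 < q i" if "i < k" for i
    using q(1)[OF that] mult_pos_pos[OF q0 \<rho>(1)] by linarith
  have q_le: "q i powr \<alpha> \<le> w" if "i < k" for i
    using powr_mono2[of \<alpha> "q i" \<rho>] q(2)[OF that] q_pos[OF that] alpha_pos \<rho>_powr by simp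
  have q_ge: "q0 powr \<alpha> * w \<le> q i powr \<alpha>" if "i < k" for i
    using powr_mono2[of \<alpha> "q0 * \<rho>" "q i"] q(1)[OF that] q0 \<rho>(1) alpha_pos \<rho>_powr
    by (simp add: powr_mult)
  have near_x: "dist (\<psi> i z) (x i) \<le> \<rho> * \<Delta>" if "i < k" "z \<in> F" for i z
  proof -
    have "x i \<in> \<psi> i ` F" using x\<psi>[OF that(1)] .
    then obtain y where y: "y \<in> F" "x i = \<psi> i y" by blast
    have "dist (\<psi> i z) (x i) = q i * dist z y"
      using sim[OF that(1)] y(2) by (simp add: similarity_with_ratio_def)
    also have "\<dots> \<le> \<rho> * \<Delta>"
      using q(2)[OF that(1)] \<rho>(1) \<Delta>(2)[OF that(2) y(1)] by (intro mult_mono) auto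
    finally show ?thesis .
  qed
  have f1_M: "\<bar>f1 z\<bar> \<le> M" if "z \<in> F" for z using M(2)[OF that] e1 by linarith
  have amplitude: "\<bar>q i powr \<alpha> * f1 z\<bar> \<le> w * M" if "i < k" "z \<in> F" for i z
    using mult_mono[OF q_le[OF that(1)] f1_M[OF that(2)]] w(1) by (simp add: abs_mult)

  define I where "I = {..<k} \<times> F"
  define p where "p = (\<lambda>(i, z). \<psi> i z)"
  define v where "v = (\<lambda>(i, z). r i + q i powr \<alpha> * f1 z)"
  \<comment> \<open>The Hoelder condition across copies. For close points the Lipschitz bound, for distant points the
    constant \<open>c < 1\<close> leaves room for the additional \<open>\<sigma> / 2\<close>.\<close>
  have cross: "\<bar>r i - r j\<bar> + \<sigma> / 2 \<le> dist (\<psi> i y) (\<psi> j z) powr \<alpha>"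
    if ij: "i < k" "j < k" "i \<noteq> j" and yz: "y \<in> F" "z \<in> F" for i j y z
  proof -
    define D where "D = dist (x i) (x j)"
    have r_c: "\<bar>r i - r j\<bar> \<le> c * D powr \<alpha>" and r_n: "\<bar>r i - r j\<bar> \<le> n * D"
      using f2(5,6)[OF x(1)[OF ij(1)] x(1)[OF ij(2)]] x(2) ij by (auto simp: D_def)
    have \<sigma>D: "\<sigma> \<le> n * D" using r_n r_sep[OF ij(3)] by linarith
    then have D_ge: "\<sigma> / n \<le> D" using f2(4) by (simp add: field_simps)
    have "D \<le> dist (x i) (\<psi> i y) + dist (\<psi> i y) (\<psi> j z) + dist (\<psi> j z) (x j)"
      unfolding D_def using dist_triangle[of "x i" "x j" "\<psi> i y"] dist_triangle[of "\<psi> i y" "x j" "\<psi> j z"]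
      by linarith
    then have "D - 2 * \<rho> * \<Delta> \<le> dist (\<psi> i y) (\<psi> j z)"
      using near_x[OF ij(1) yz(1)] near_x[OF ij(2) yz(2)] by (simp add: dist_commute)
    moreover have "\<tau> * (\<sigma> / n) \<le> \<tau> * D" using D_ge \<tau>(1) by (intro mult_left_mono) auto
    ultimately have dist_ge: "(1 - \<tau>) * D \<le> dist (\<psi> i y) (\<psi> j z)"
      using sep_small by (simp add: left_diff_distrib)
    have D0: "0 \<le> D" by (simp add: D_def)
    have "1 - \<tau> \<le> (1 - \<tau>) powr \<alpha>"
      using \<tau> alpha_less_1 powr_mono'[of \<alpha> 1 "1 - \<tau>"] by simp
    then have "(1 - \<tau>) * D powr \<alpha> \<le> (1 - \<tau>) powr \<alpha> * D powr \<alpha>" by (intro mult_right_mono) auto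
    also have "\<dots> = ((1 - \<tau>) * D) powr \<alpha>" using \<tau> D0 by (simp add: powr_mult)
    also have "\<dots> \<le> dist (\<psi> i y) (\<psi> j z) powr \<alpha>"
      using dist_ge \<tau> D0 alpha_pos by (intro powr_mono2) auto
    finally have lower: "(1 - \<tau>) * D powr \<alpha> \<le> dist (\<psi> i y) (\<psi> j z) powr \<alpha>" .
    have "\<bar>r i - r j\<bar> + \<sigma> / 2 \<le> (1 - \<tau>) * D powr \<alpha>"
    proof (cases "D powr \<alpha> \<le> w2")
      case True
      have "D = (D powr \<alpha>) powr (1 / \<alpha>)" using D0 alpha_pos by (simp add: powr_powr)
      also have "\<dots> \<le> ((1 - \<tau>) / (3 / 2 * n)) * D powr \<alpha>" using w2(2)[OF _ True] by simp
      finally have "3 / 2 * n * D \<le> 3 / 2 * n * (((1 - \<tau>) / (3 / 2 * n)) * D powr \<alpha>)"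
        using f2(4) by (intro mult_left_mono) auto
      also have "\<dots> = (1 - \<tau>) * D powr \<alpha>" using f2(4) by (simp add: field_simps)
      finally show ?thesis using r_n \<sigma>D by linarith
    next
      case False
      then have "\<tau> * w2 \<le> \<tau> * D powr \<alpha>" using \<tau>(1) by simp
      then have "\<bar>r i - r j\<bar> + \<sigma> / 2 \<le> c * D powr \<alpha> + \<tau> * D powr \<alpha>"
        using gap_small r_c by linarith
      also have "\<dots> = (1 - \<tau>) * D powr \<alpha>" using \<tau>(3) by (simp flip: distrib_right)
      finally show ?thesis .
    qed
    with lower show ?thesis by linarith
  qed
  have v_holder: "v \<iota> \<le> v \<kappa> + dist (p \<iota>) (p \<kappa>) powr \<alpha>" if in_I: "\<iota> \<in> I" "\<kappa> \<in> I" for \<iota> \<kappa>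
  proof -
    obtain i y j z where \<iota>: "\<iota> = (i, y)" "\<kappa> = (j, z)" and ij: "i < k" "j < k" and yz: "y \<in> F" "z \<in> F"
      using in_I unfolding I_def by blast
    show ?thesis
    proof (cases "i = j")
      case True
      have "f1 y \<le> f1 z + dist y z powr \<alpha>" using holder1D[OF f1 yz] by (simp add: abs_le_iff)
      then have "q i powr \<alpha> * f1 y \<le> q i powr \<alpha> * (f1 z + dist y z powr \<alpha>)" by (intro mult_left_mono) auto
      also have "\<dots> = q i powr \<alpha> * f1 z + dist (\<psi> i y) (\<psi> i z) powr \<alpha>"
        using sim[OF ij(1)] q_pos[OF ij(1)] by (simp add: similarity_with_ratio_def powr_mult distrib_left)
      finally show ?thesis using True by (simp add: \<iota> v_def p_def)
    next
      case False
      then show ?thesis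
        using cross[OF ij False yz] amplitude[OF ij(1) yz(1)] amplitude[OF ij(2) yz(2)] w(2)
        unfolding \<iota> v_def p_def by (simp add: abs_le_iff)
    qed
  qed
  have v_near: "\<bar>v \<iota> - f2 (p \<iota>)\<bar> \<le> e" if in_I: "\<iota> \<in> I" for \<iota>
  proof -
    obtain i z where \<iota>: "\<iota> = (i, z)" "i < k" "z \<in> F" using in_I unfolding I_def by blast
    have "\<psi> i z \<in> F" using \<psi>F \<iota> by blast
    then have "\<bar>f2 (\<psi> i z) - f2 (x i)\<bar> \<le> dist (\<psi> i z) (x i) powr \<alpha>"
      using x(1) \<iota>(2) by (intro holder1D[OF f2(1)])
    also have "\<dots> \<le> (\<rho> * \<Delta>) powr \<alpha>"
      using near_x[OF \<iota>(2,3)] alpha_pos by (intro powr_mono2) auto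
    also have "\<dots> = w * \<Delta> powr \<alpha>" using \<rho>(1) \<Delta>(1) \<rho>_powr by (simp add: powr_mult)
    finally show ?thesis
      using amplitude[OF \<iota>(2,3)] near_small x(2)[OF \<iota>(2)] unfolding \<iota> v_def p_def by (simp add: abs_le_iff)
  qed
  have p_in: "p \<iota> \<in> F" if in_I: "\<iota> \<in> I" for \<iota>
  proof -
    obtain i z where \<iota>: "\<iota> = (i, z)" "i < k" "z \<in> F" using in_I unfolding I_def by blast
    then show ?thesis using image_subset_iff[THEN iffD1, OF \<psi>F[OF \<iota>(2)]] by (simp add: p_def)
  qed
  obtain g where g: "g \<in> X" "\<And>\<iota>. \<iota> \<in> I \<Longrightarrow> g (p \<iota>) = v \<iota>" "close e f2 g"
    using holder_extension_near[where I = I and p = p and v = v, OF f2(1) p_in less_imp_le[OF e] v_holder v_near] by metis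
  have g_copy: "g (\<psi> i z) = r i + q i powr \<alpha> * f1 z" if "i < k" "z \<in> F" for i z
    using g(2)[of "(i, z)"] that by (simp add: I_def p_def v_def)

  \<comment> \<open>On the smallest possible copy, heights are magnified by \<open>1 / (q0 powr \<alpha> * w)\<close>, so a change by at
    most \<open>d\<close> keeps the rescaled function within \<open>e1\<close> of \<open>f1\<close>.\<close>
  define d where "d = e1 * (q0 powr \<alpha> * w)"
  have d: "0 < d" using e1 q0 w(1) by (simp add: d_def)
  show ?thesis
  proof (rule that[OF g(1,3) d])
    fix h assume h: "h \<in> X" "close d g h"
    define h' where "h' i = rescale (\<psi> i) (q i) (r i) h" for i
    define T where "T i = {t. (t - r i) / q i powr \<alpha> \<in> fat s \<eta> (h' i)}" for i
    have h'_X: "h' i \<in> X" if "i < k" for i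
      unfolding h'_def using h(1) sim[OF that] q_pos[OF that] \<psi>F[OF that] by (rule rescale_holder1)
    have h'_close: "close e1 f1 (h' i)" if "i < k" for i
      unfolding close_def
    proof
      fix z assume z: "z \<in> F"
      have qp: "0 < q i powr \<alpha>" using q_pos[OF that] by simp
      have "\<bar>g (\<psi> i z) - h (\<psi> i z)\<bar> \<le> d" using h(2) \<psi>F[OF that] z unfolding close_def by blast
      also have "\<dots> \<le> e1 * q i powr \<alpha>" unfolding d_def using q_ge[OF that] e1 by (intro mult_left_mono) auto
      finally have "\<bar>g (\<psi> i z) - h (\<psi> i z)\<bar> / q i powr \<alpha> \<le> e1" using qp by (simp add: pos_divide_le_eq)
      moreover have "f1 z - h' i z = (g (\<psi> i z) - h (\<psi> i z)) / q i powr \<alpha>"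
        using z qp by (simp add: h'_def rescale_def g_copy[OF that z] field_simps)
      ultimately show "\<bar>f1 z - h' i z\<bar> \<le> e1" using qp by (simp add: abs_divide)
    qed
    have T_meas: "T i \<in> sets borel" if "i < k" for i
    proof -
      have "(\<lambda>t. (t - r i) / q i powr \<alpha>) -` fat s \<eta> (h' i) \<inter> space borel \<in> sets borel"
        using closed_fat[OF h'_X[OF that]] by (intro measurable_sets[where A = borel]) auto
      then show ?thesis by (simp add: T_def vimage_def)
    qed
    have T_size: "ennreal (q0 powr \<alpha> * w * \<eta>) \<le> emeasure lborel (T i)" if "i < k" for i
    proof -
      have "emeasure lborel (T i) = ennreal (q i powr \<alpha>) * emeasure lborel (fat s \<eta> (h' i))"
        unfolding T_def using closed_fat[OF h'_X[OF that]] q_pos[OF that]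
        by (intro emeasure_affine_vimage) auto
      moreover have "ennreal (q0 powr \<alpha> * w * \<eta>) = ennreal (q0 powr \<alpha> * w) * ennreal \<eta>"
        using w(1) \<eta> by (intro ennreal_mult) auto
      moreover have "ennreal (q0 powr \<alpha> * w) * ennreal \<eta> \<le> ennreal (q i powr \<alpha>) * emeasure lborel (fat s \<eta> (h' i))"
        using q_ge[OF that] fat_large[OF h'_X[OF that] h'_close[OF that]]
        by (intro mult_mono ennreal_leI) auto
      ultimately show ?thesis by simp
    qed
    have T_near: "\<bar>t - r i\<bar> \<le> \<sigma> / 4" if "i < k" "t \<in> T i" for i t
    proof -
      have "(t - r i) / q i powr \<alpha> \<in> h' i ` F"
        using that(2) fat_subset_image[OF \<eta>, of s "h' i"] by (auto simp: T_def)
      then obtain z where z: "z \<in> F" "(t - r i) / q i powr \<alpha> = h' i z" by blast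
      have "\<bar>h' i z\<bar> \<le> M"
        using h'_close[OF that(1)] M(2)[OF z(1)] z(1) unfolding close_def by force
      then have "q i powr \<alpha> * \<bar>h' i z\<bar> \<le> w * M"
        using q_le[OF that(1)] w(1) by (intro mult_mono) auto
      moreover have "t - r i = q i powr \<alpha> * h' i z" using z(2) q_pos[OF that(1)] by (simp add: field_simps)
      ultimately show ?thesis using w(2) by (simp add: abs_mult)
    qed
    have T_sub: "T i \<subseteq> non_null s h \<inter> {a<..<b}" if "i < k" for i
    proof
      fix t assume t: "t \<in> T i"
      have "t \<in> fat s (\<eta> * q i powr s) h"
        using t fat_rescale[OF sim[OF that] q_pos[OF that] \<psi>F[OF that] s] unfolding T_def h'_def by blast
      then have "t \<in> non_null s h"
        using fat_subset_non_null[OF s, of "\<eta> * q i powr s" h] \<eta> q_pos[OF that] by auto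
      moreover have "a < t" "t < b"
        using T_near[OF that t] r_in[OF that] \<sigma>(1) by linarith+
      ultimately show "t \<in> non_null s h \<inter> {a<..<b}" by simp
    qed
    have disj: "disjoint_family_on T {..<k}"
      unfolding disjoint_family_on_def
    proof (intro ballI impI)
      fix i j assume ij: "i \<in> {..<k}" "j \<in> {..<k}" "i \<noteq> j"
      show "T i \<inter> T j = {}"
      proof (rule ccontr)
        assume "T i \<inter> T j \<noteq> {}"
        then obtain t where "t \<in> T i" "t \<in> T j" by blast
        then have "\<bar>t - r i\<bar> \<le> \<sigma> / 4" "\<bar>t - r j\<bar> \<le> \<sigma> / 4" using T_near ij by auto
        then show False using r_sep[OF ij(3)] \<sigma>(1) by linarith
      qed
    qed
    have "q0 powr \<alpha> * \<eta> / (4 * M) * (b - a) = real k * (q0 powr \<alpha> * w * \<eta>)"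
      using \<sigma>(2) M(1) by (simp add: w_def flip: L_def \<sigma>(2))
    also have "ennreal \<dots> = (\<Sum>i<k. ennreal (q0 powr \<alpha> * w * \<eta>))"
      using w(1) \<eta> by (simp add: ennreal_mult ennreal_of_nat_eq_real_of_nat)
    also have "\<dots> \<le> (\<Sum>i<k. emeasure lborel (T i))"
      using T_size by (intro sum_mono) auto
    also have "\<dots> = emeasure lborel (\<Union>i<k. T i)"
      using T_meas disj by (intro sum_emeasure) auto
    also have "\<dots> \<le> emeasure lborel (non_null s h \<inter> {a<..<b})"
      using T_sub non_null_borel[OF h(1) s] by (intro emeasure_mono) auto
    finally show "ennreal (q0 powr \<alpha> * \<eta> / (4 * M) * (b - a)) \<le> emeasure lborel (non_null s h \<inter> {a<..<b})" .
  qed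
qed

end

section \<open>The zero-one law for Hausdorff measures of level sets\<close>

text \<open>
  An open set is, up to a countable set, a countable disjoint union of open intervals, on each of which
  the bound is assumed.
\<close>
lemma open_set_proportion:
  fixes G V :: "real set"
  assumes G: "G \<in> sets borel" and \<kappa>: "0 \<le> \<kappa>" and V: "open V" "V \<subseteq> {l<..<u}"
    and proportion: "\<And>a b. a < b \<Longrightarrow> {a..b} \<subseteq> {l..u} \<Longrightarrow> ennreal (\<kappa> * (b - a)) \<le> emeasure lborel (G \<inter> {a<..<b})"
  shows "ennreal \<kappa> * emeasure lborel V \<le> emeasure lborel (G \<inter> V)"
proof (cases "V = {}")
  case False
  then have lu: "l < u" using V(2) by force
  have "gauge (\<lambda>x. if x \<in> V then V else UNIV)" using V(1) by (auto simp: gauge_def)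
  moreover have "V \<subseteq> cbox l u" "box l u \<noteq> {}" using V(2) lu by (auto simp: box_real)
  ultimately obtain \<D> where \<D>: "countable \<D>" "\<And>K. K \<in> \<D> \<Longrightarrow> interior K \<noteq> {} \<and> (\<exists>c d. K = cbox c d)"
      "pairwise (\<lambda>A B. interior A \<inter> interior B = {}) \<D>"
      "\<And>K. K \<in> \<D> \<Longrightarrow> \<exists>x \<in> V \<inter> K. K \<subseteq> (if x \<in> V then V else UNIV)" "V \<subseteq> \<Union>\<D>"
    using covering_lemma[of V l u "\<lambda>x. if x \<in> V then V else UNIV"] by metis
  have KV: "K \<subseteq> V" if "K \<in> \<D>" for K using \<D>(4)[OF that] by auto
  have Kab: "\<exists>a b. a < b \<and> K = {a..b}" if K: "K \<in> \<D>" for K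
  proof -
    obtain a b where ab: "K = cbox a b" using \<D>(2)[OF K] by blast
    then have "a < b" using \<D>(2)[OF K] by (cases "a < b") (auto simp: interior_cbox box_real)
    then show ?thesis using ab by (auto simp: box_real)
  qed
  have disj: "disjoint_family_on interior \<D>"
    using \<D>(3) by (auto simp: disjoint_family_on_def pairwise_def)
  have null: "V - (\<Union>K\<in>\<D>. interior K) \<in> null_sets lborel"
  proof -
    have "countable (\<Union>K\<in>\<D>. K - interior K)"
    proof (intro countable_UN \<D>(1))
      fix K assume "K \<in> \<D>"
      then obtain a b where "a < b" "K = {a..b}" using Kab by blast
      then have "K - interior K = {a, b}" by (auto simp: interior_atLeastAtMost_real)
      then show "countable (K - interior K)" by simp
    qed
    then have "countable (V - (\<Union>K\<in>\<D>. interior K))"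
      by (rule countable_subset[rotated]) (use \<D>(5) in blast)
    then show ?thesis by (rule countable_imp_null_set_lborel)
  qed
  have "V = (\<Union>K\<in>\<D>. interior K) \<union> (V - (\<Union>K\<in>\<D>. interior K))"
    using KV interior_subset by blast
  then have "emeasure lborel V = emeasure lborel (\<Union>K\<in>\<D>. interior K)"
    using emeasure_Un_null_set[OF _ null, of "\<Union>K\<in>\<D>. interior K"] by (simp add: borel_open open_UN)
  also have "\<dots> = (\<integral>\<^sup>+K. emeasure lborel (interior K) \<partial>count_space \<D>)"
    using \<D>(1) disj by (intro emeasure_UN_countable) auto
  finally have "ennreal \<kappa> * emeasure lborel V = (\<integral>\<^sup>+K. ennreal \<kappa> * emeasure lborel (interior K) \<partial>count_space \<D>)"
    by (simp add: nn_integral_cmult)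
  also have "\<dots> \<le> (\<integral>\<^sup>+K. emeasure lborel (G \<inter> interior K) \<partial>count_space \<D>)"
  proof (intro nn_integral_mono)
    fix K assume "K \<in> space (count_space \<D>)"
    then have K: "K \<in> \<D>" by simp
    obtain a b where ab: "a < b" "K = {a..b}" using Kab[OF K] by blast
    have "{a..b} \<subseteq> {l..u}" using KV[OF K] V(2) ab by (meson greaterThanLessThan_subseteq_atLeastAtMost_iff order_refl order_trans)
    from proportion[OF ab(1) this] show "ennreal \<kappa> * emeasure lborel (interior K) \<le> emeasure lborel (G \<inter> interior K)"
      using ab \<kappa> by (simp add: interior_atLeastAtMost_real ennreal_mult)
  qed
  also have "\<dots> = emeasure lborel (\<Union>K\<in>\<D>. G \<inter> interior K)"
    using \<D>(1) disj G by (intro emeasure_UN_countable[symmetric]) (auto simp: disjoint_family_on_def)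
  also have "\<dots> \<le> emeasure lborel (G \<inter> V)"
  proof (rule emeasure_mono)
    show "(\<Union>K\<in>\<D>. G \<inter> interior K) \<subseteq> G \<inter> V" using KV interior_subset by blast
    show "G \<inter> V \<in> sets lborel" using G V(1) by simp
  qed
  finally show ?thesis .
qed simp

text \<open>
  A weak form of the density theorem, sufficient here because the proportion \<open>\<kappa>\<close> is the same for
  all intervals. If the complement \<open>B\<close> of \<open>G\<close> had positive measure \<open>\<beta>\<close>, an open set \<open>W\<close> around \<open>B\<close>
  with \<open>W - B\<close> of measure less than \<open>\<kappa> * \<beta>\<close> would contain too little of \<open>G\<close>.
\<close>
lemma full_measure_if_uniform_proportion:
  fixes G :: "real set"
  assumes G: "G \<in> sets borel" and \<kappa>: "0 < \<kappa>"
    and proportion: "\<And>a b. a \<in> \<rat> \<Longrightarrow> b \<in> \<rat> \<Longrightarrow> a < b \<Longrightarrow> {a..b} \<subseteq> {l..u} \<Longrightarrow>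
      ennreal (\<kappa> * (b - a)) \<le> emeasure lborel (G \<inter> {a<..<b})"
  shows "emeasure lborel ({l..u} - G) = 0"
proof -
  have prop_real: "ennreal (\<kappa> * (b - a)) \<le> emeasure lborel (G \<inter> {a<..<b})" if ab: "a < b" "{a..b} \<subseteq> {l..u}" for a b
  proof (rule ennreal_le_epsilon)
    fix e :: real assume e: "0 < e"
    define \<delta> where "\<delta> = min ((b - a) / 2) (e / (2 * \<kappa>))"
    have \<delta>: "0 < \<delta>" "\<delta> \<le> (b - a) / 2" "\<delta> \<le> e / (2 * \<kappa>)" using ab e \<kappa>
      unfolding \<delta>_def by (simp, intro min.cobounded1, intro min.cobounded2)
    obtain a' where a': "a' \<in> \<rat>" "a < a'" "a' < a + \<delta>" using Rats_dense_in_real[of a "a + \<delta>"] \<delta> by auto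
    obtain b' where b': "b' \<in> \<rat>" "b - \<delta> < b'" "b' < b" using Rats_dense_in_real[of "b - \<delta>" b] \<delta> by auto
    have "\<kappa> * (2 * \<delta>) \<le> e" using \<delta>(3) \<kappa> by (simp add: field_simps)
    moreover have "\<kappa> * (b - a) \<le> \<kappa> * (b' - a' + 2 * \<delta>)" using a' b' \<kappa> by (intro mult_left_mono) auto
    ultimately have "\<kappa> * (b - a) \<le> \<kappa> * (b' - a') + e" by (simp add: distrib_left)
    then have "ennreal (\<kappa> * (b - a)) \<le> ennreal (\<kappa> * (b' - a') + e)" by (rule ennreal_leI)
    moreover have less: "a' < b'" using a'(3) b'(2) \<delta>(2) by argo
    ultimately have "ennreal (\<kappa> * (b - a)) \<le> ennreal (\<kappa> * (b' - a')) + ennreal e"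
      using \<kappa> e by simp
    moreover have "{a'..b'} \<subseteq> {l..u}" using a' b' by (intro order_trans[OF _ ab(2)]) auto
    then have "ennreal (\<kappa> * (b' - a')) \<le> emeasure lborel (G \<inter> {a'<..<b'})"
      by (rule proportion[OF a'(1) b'(1) less])
    moreover have "emeasure lborel (G \<inter> {a'<..<b'}) \<le> emeasure lborel (G \<inter> {a<..<b})"
      using a' b' G by (intro emeasure_mono) auto
    ultimately show "ennreal (\<kappa> * (b - a)) \<le> emeasure lborel (G \<inter> {a<..<b}) + ennreal e"
      by (meson add_right_mono order_trans)
  qed
  define B where "B = {l<..<u} - G"
  have B: "B \<in> sets borel" using G by (simp add: B_def)
  have "emeasure lborel B = 0"
  proof (rule ccontr)
    assume "emeasure lborel B \<noteq> 0"
    moreover have "emeasure lborel B \<le> emeasure lborel {l<..<u}" by (intro emeasure_mono) (auto simp: B_def)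
    then have fin: "emeasure lborel B < \<infinity>" by (rule le_less_trans) (cases "l \<le> u", auto)
    ultimately obtain \<beta> where \<beta>: "0 < \<beta>" "emeasure lborel B = ennreal \<beta>"
      by (cases "emeasure lborel B") (auto simp: ennreal_eq_0_iff not_le)
    obtain W where W: "open W" "B \<subseteq> W" "emeasure lborel (W - B) < ennreal (\<kappa> * \<beta>)"
      using outer_regular_lborel[OF B, of "\<kappa> * \<beta>"] \<kappa> \<beta>(1) by auto
    define V where "V = W \<inter> {l<..<u}"
    have V: "open V" "V \<subseteq> {l<..<u}" "B \<subseteq> V" using W by (auto simp: V_def B_def)
    have "ennreal (\<kappa> * \<beta>) = ennreal \<kappa> * emeasure lborel B"
      using \<kappa> \<beta> by (simp add: ennreal_mult)
    also have "\<dots> \<le> ennreal \<kappa> * emeasure lborel V"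
      using V by (intro mult_left_mono emeasure_mono) auto
    also have "\<dots> \<le> emeasure lborel (G \<inter> V)"
      using G \<kappa> V(1,2) prop_real by (intro open_set_proportion) auto
    also have "\<dots> \<le> emeasure lborel (W - B)"
      using W(1) B by (intro emeasure_mono) (auto simp: V_def B_def)
    finally show False using W(3) by simp
  qed
  then have "B \<in> null_sets lborel" using B by auto
  moreover have "{l, u} \<in> null_sets lborel" by (intro countable_imp_null_set_lborel) simp
  ultimately have "B \<union> {l, u} \<in> null_sets lborel" by (rule null_sets.Un)
  then have "{l..u} - G \<in> null_sets lborel"
    by (rule null_sets_subset) (use G in \<open>auto simp: B_def\<close>)
  then show ?thesis by auto
qed

context holder_functions_with_copies
begin

lemma image_interval:
  assumes "f \<in> X"
  obtains l u where "f ` F = {l..u}"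
proof -
  have "connected (f ` F)" "compact (f ` F)"
    using holder1_continuous[OF assms] connected_F compact_F
    by (auto intro: connected_continuous_image compact_continuous_image)
  then show ?thesis using that connected_compact_interval_1 by metis
qed

text \<open>
  If the range of the Lipschitz approximation \<open>f2\<close> contains \<open>[a, b]\<close>, copies are inserted; otherwise
  the range omits a value of \<open>[a, b]\<close>, and so do the ranges of all functions close to \<open>f2\<close>.
\<close>
lemma generic_positive_proportion:
  assumes f1: "f1 \<in> X" and e1: "0 < e1" and s: "0 < s" and \<eta>: "0 < \<eta>"
    and fat_large: "\<And>f. f \<in> X \<Longrightarrow> close e1 f1 f \<Longrightarrow> ennreal \<eta> \<le> emeasure lborel (fat s \<eta> f)"
  shows "\<exists>\<kappa>>0. \<forall>a b. a < b \<longrightarrow> generic {f. {a..b} \<subseteq> f ` F \<longrightarrow>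
    ennreal (\<kappa> * (b - a)) \<le> emeasure lborel (non_null s f \<inter> {a<..<b})}"
proof -
  obtain B where B: "0 < B" "\<And>x. x \<in> F \<Longrightarrow> \<bar>f1 x\<bar> \<le> B" using holder1_bounded[OF f1] by blast
  define M where "M = B + e1"
  have M: "0 < M" "\<And>x. x \<in> F \<Longrightarrow> \<bar>f1 x\<bar> + e1 \<le> M" using B e1 by (auto simp: M_def)
  show ?thesis
  proof (intro exI conjI allI impI)
    show "0 < q0 powr \<alpha> * \<eta> / (4 * M)" using q0 \<eta> M(1) by simp
    fix a b :: real assume ab: "a < b"
    let ?P = "\<lambda>f. {a..b} \<subseteq> f ` F \<longrightarrow>
      ennreal (q0 powr \<alpha> * \<eta> / (4 * M) * (b - a)) \<le> emeasure lborel (non_null s f \<inter> {a<..<b})"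
    show "generic {f. ?P f}"
    proof (rule generic_if_densely_stable)
      fix f0 and e :: real assume f0: "f0 \<in> X" and e: "0 < e"
      obtain f2 c n where f2: "f2 \<in> X" "close (e / 2) f0 f2" "0 < c" "c < 1" "0 < n"
          "\<And>x y. x \<in> F \<Longrightarrow> y \<in> F \<Longrightarrow> \<bar>f2 x - f2 y\<bar> \<le> c * dist x y powr \<alpha>"
          "\<And>x y. x \<in> F \<Longrightarrow> y \<in> F \<Longrightarrow> \<bar>f2 x - f2 y\<bar> \<le> n * dist x y"
        using lipschitz_approximation[OF f0, of "e / 2"] e by auto
      show "\<exists>g\<in>X. close e f0 g \<and> (\<exists>d>0. \<forall>h\<in>X. close d g h \<longrightarrow> ?P h)"
      proof (cases "{a..b} \<subseteq> f2 ` F")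
        case True
        obtain g d where g: "g \<in> X" "close (e / 2) f2 g" "0 < d" 
            "\<And>h. h \<in> X \<Longrightarrow> close d g h \<Longrightarrow>
              ennreal (q0 powr \<alpha> * \<eta> / (4 * M) * (b - a)) \<le> emeasure lborel (non_null s h \<inter> {a<..<b})"
          using insert_copies[OF f1 s \<eta> M e1 fat_large f2(1) f2(3) f2(4) f2(5) f2(6) f2(7) ab True half_gt_zero[OF e]]
          by metis
        moreover have "close e f0 g" using close_triangle[OF f2(2) g(2)] by simp
        ultimately show ?thesis by blast
      next
        case False
        then obtain v where v: "v \<in> {a..b}" "v \<notin> f2 ` F" by blast
        then have "level f2 v \<subseteq> {}" by auto
        then obtain d where d: "0 < d" "\<And>g r. close d f2 g \<Longrightarrow> \<bar>r - v\<bar> \<le> d \<Longrightarrow> level g r \<subseteq> {}"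
          using level_near_subset_open[OF f2(1) open_empty, of v] by metis
        have "?P h" if "close d f2 h" for h
        proof -
          have "level h v \<subseteq> {}" using d(2)[OF that, of v] d(1) by simp
          then have "v \<notin> h ` F" by auto
          then show ?thesis using v(1) by blast
        qed
        moreover have "close e f0 f2" using close_mono[OF f2(2)] e by simp
        ultimately show ?thesis using f2(1) d(1) by blast
      qed
    qed
  qed
qed

text \<open>
  The sets \<open>V n\<close> are open. If all are dense, their intersection consists of functions with almost
  no non-null level sets. If one is not dense, the ball that it misses is the input of the copying
  construction, and only intervals with rational end points are needed to get full measure.
\<close>
lemma generic_null_or_full:
  assumes s: "0 < s"
  shows "generic {f. emeasure lborel (non_null s f) = 0} \<or>
         generic {f. emeasure lborel (f ` F - non_null s f) = 0}"
proof -
  define V where "V n = {f \<in> X. emeasure lborel (fat s (1 / real (Suc n)) f) < ennreal (1 / real (Suc n))}" for n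
  have V_open: "openin XT (V n)" for n
    unfolding openin_iff
  proof (intro conjI ballI)
    fix f assume "f \<in> V n"
    then have "f \<in> X" "emeasure lborel (fat s (1 / real (Suc n)) f) < ennreal (1 / real (Suc n))"
      by (auto simp: V_def)
    from measure_fat_upper_semicontinuous[OF this(1) _ this(2)]
    obtain d where "0 < d" "\<And>g. g \<in> X \<Longrightarrow> close d f g \<Longrightarrow>
        emeasure lborel (fat s (1 / real (Suc n)) g) < ennreal (1 / real (Suc n))"
      by (metis of_nat_0_less_iff zero_less_Suc zero_less_divide_1_iff)
    then show "\<exists>e>0. \<forall>g\<in>X. close e f g \<longrightarrow> g \<in> V n" unfolding V_def by blast
  qed (auto simp: V_def)
  show ?thesis
  proof (cases "\<forall>n. XT closure_of V n = X")
    case True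
    have "generic (V n)" for n
      using V_open True by (intro open_dense_imp_generic) (simp add: open_dense_def)
    then have "generic (\<Inter>n. V n)" by (intro generic_INT) auto
    moreover have "emeasure lborel (non_null s f) = 0" if f: "f \<in> (\<Inter>n. V n)" for f
    proof -
      have fX: "f \<in> X" using f by (auto simp: V_def)
      have "fat s (1 / real (Suc m)) f \<in> null_sets lborel" for m
      proof -
        have "emeasure lborel (fat s (1 / real (Suc m)) f) \<le> 0"
        proof (rule ennreal_le_epsilon)
          fix e :: real assume "0 < e"
          then obtain n where n: "1 / real (Suc n) < e" using nat_approx_posE by blast
          define N where "N = max m n"
          have N: "1 / real (Suc N) \<le> 1 / real (Suc m)" "1 / real (Suc N) \<le> 1 / real (Suc n)"
            by (auto simp: N_def intro!: divide_left_mono)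
          have "emeasure lborel (fat s (1 / real (Suc m)) f) \<le> emeasure lborel (fat s (1 / real (Suc N)) f)"
            using fat_antimono[OF N(1)] closed_fat[OF fX] by (intro emeasure_mono) auto
          also have "\<dots> \<le> ennreal (1 / real (Suc N))"
            using f unfolding V_def by (metis (mono_tags, lifting) INT_D UNIV_I mem_Collect_eq order_less_imp_le)
          also have "\<dots> \<le> ennreal e" using N(2) n by (intro ennreal_leI) linarith
          finally show "emeasure lborel (fat s (1 / real (Suc m)) f) \<le> 0 + ennreal e" by simp
        qed
        then show ?thesis using closed_fat[OF fX] by (auto intro!: null_setsI)
      qed
      then have "non_null s f \<in> null_sets lborel"
        unfolding non_null_eq_Union_fat[OF s] by (intro null_sets_UN) auto
      then show ?thesis by auto
    qed
    ultimately show ?thesis by (auto elim!: generic_mono)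
  next
    case False
    then obtain n where "XT closure_of V n \<noteq> X" by blast
    then obtain f1 e1 where f1: "f1 \<in> X" "0 < e1" "\<And>g. g \<in> V n \<Longrightarrow> g \<in> X \<Longrightarrow> \<not> close e1 f1 g"
      unfolding dense_iff by blast
    have large: "ennreal (1 / real (Suc n)) \<le> emeasure lborel (fat s (1 / real (Suc n)) f)"
      if "f \<in> X" "close e1 f1 f" for f
    proof -
      have "f \<notin> V n" using f1(3)[of f] that by blast
      then show ?thesis using that(1) by (simp add: V_def not_less del: of_nat_Suc)
    qed
    have pos: "0 < 1 / real (Suc n)" by simp
    have "\<exists>\<kappa>>0. \<forall>a b. a < b \<longrightarrow> generic {f. {a..b} \<subseteq> f ` F \<longrightarrow>
        ennreal (\<kappa> * (b - a)) \<le> emeasure lborel (non_null s f \<inter> {a<..<b})}"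
      by (rule generic_positive_proportion[OF f1(1,2) s pos]) (rule large; assumption)
    then obtain \<kappa> where \<kappa>: "0 < \<kappa>" "\<forall>a b. a < b \<longrightarrow> generic {f. {a..b} \<subseteq> f ` F \<longrightarrow>
        ennreal (\<kappa> * (b - a)) \<le> emeasure lborel (non_null s f \<inter> {a<..<b})}"
      by (elim exE conjE)
    define J where "J = {(a, b). a \<in> \<rat> \<and> b \<in> \<rat> \<and> a < (b :: real)}"
    have "countable J"
      by (rule countable_subset[of _ "\<rat> \<times> \<rat>"]) (auto simp: J_def countable_rat)
    then have "generic (\<Inter>(a, b)\<in>J. {f. {a..b} \<subseteq> f ` F \<longrightarrow>
        ennreal (\<kappa> * (b - a)) \<le> emeasure lborel (non_null s f \<inter> {a<..<b})})"
      by (rule generic_INT) (use \<kappa>(2) in \<open>auto simp: J_def\<close>)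
    moreover have "emeasure lborel (f ` F - non_null s f) = 0"
      if f: "f \<in> X" "f \<in> (\<Inter>(a, b)\<in>J. {f. {a..b} \<subseteq> f ` F \<longrightarrow>
        ennreal (\<kappa> * (b - a)) \<le> emeasure lborel (non_null s f \<inter> {a<..<b})})" for f
    proof -
      obtain l u where lu: "f ` F = {l..u}" using image_interval[OF f(1)] .
      show ?thesis
        unfolding lu
      proof (rule full_measure_if_uniform_proportion[OF non_null_borel[OF f(1) s] \<kappa>(1)])
        fix a b :: real assume "a \<in> \<rat>" "b \<in> \<rat>" "a < b" "{a..b} \<subseteq> {l..u}"
        then show "ennreal (\<kappa> * (b - a)) \<le> emeasure lborel (non_null s f \<inter> {a<..<b})"
          using f(2) unfolding lu[symmetric] by (auto simp: J_def)
      qed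
    qed
    ultimately have "generic {f. emeasure lborel (f ` F - non_null s f) = 0}"
      by (rule generic_CollectI)
    then show ?thesis ..
  qed
qed

end

section \<open>The generic level dimension\<close>

context holder_functions
begin

lemma image_compact: "f \<in> X \<Longrightarrow> compact (f ` F)"
  using holder1_continuous compact_F by (intro compact_continuous_image)

lemma level_dim_outside_image: "r \<notin> f ` F \<Longrightarrow> level_dim f r F = 0"
proof -
  assume "r \<notin> f ` F"
  then have "level f r = {}" by auto
  then show ?thesis unfolding level_dim_def by (simp only: hausdorff_dim_empty)
qed

text \<open>
  For \<open>d' > 0\<close>, the values with level dimension at least \<open>d'\<close> lie in \<open>f ` F\<close>, as empty level sets have
  dimension \<open>0\<close>. Up to null sets they are all of \<open>f ` F\<close> if \<open>d' \<le> d\<close>, and none if \<open>d' > d\<close>.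
\<close>
lemma D_star_fun_eq:
  assumes f: "f \<in> X" and image: "0 < emeasure lebesgue (f ` F)"
    and ae: "AE r in lebesgue. r \<in> f ` F \<longrightarrow> level_dim f r F = d"
  shows "D_star_fun f F = d"
proof -
  have "f ` F \<in> sets borel" using image_compact[OF f] by (intro borel_compact)
  then have image_meas: "f ` F \<in> sets lebesgue" by simp
  obtain N where N: "{r \<in> space lebesgue. \<not> (r \<in> f ` F \<longrightarrow> level_dim f r F = d)} \<subseteq> N" "N \<in> null_sets lebesgue"
    using ae unfolding eventually_ae_filter by auto
  have below: "0 < emeasure lebesgue {r. d' \<le> level_dim f r F}" if d': "d' \<le> d" for d'
  proof (cases "d' = 0")
    case True
    then show ?thesis by simp
  next
    case False
    let ?A = "{r. d' \<le> level_dim f r F}"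
    have "?A \<subseteq> f ` F" using False level_dim_outside_image[of _ f] by fastforce
    moreover have "f ` F - ?A \<subseteq> N" using N(1) d' by auto
    then have null: "f ` F - ?A \<in> null_sets lebesgue" using N(2) by (rule null_sets_completion_subset)
    ultimately have "?A = f ` F - (f ` F - ?A)" by blast
    then have "emeasure lebesgue ?A = emeasure lebesgue (f ` F)"
      using emeasure_Diff_null_set[OF null image_meas] by metis
    then show ?thesis using image by simp
  qed
  have above: "emeasure lebesgue {r. d' \<le> level_dim f r F} = 0" if d': "d < d'" for d'
  proof -
    have "{r. d' \<le> level_dim f r F} \<subseteq> N"
    proof
      fix r assume r: "r \<in> {r. d' \<le> level_dim f r F}"
      have "0 < d'" using d' by (rule le_less_trans[OF zero_le])
      with r have "r \<in> f ` F" using level_dim_outside_image[of r f] by force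
      then show "r \<in> N" using r d' N(1) by auto
    qed
    then have "{r. d' \<le> level_dim f r F} \<in> null_sets lebesgue" using N(2) by (rule null_sets_completion_subset)
    then show ?thesis by auto
  qed
  show ?thesis
    unfolding D_star_fun_def
  proof (rule antisym)
    show "Sup {d'. 0 < emeasure lebesgue {r. d' \<le> level_dim f r F}} \<le> d"
      using above by (intro Sup_least) (metis (no_types, lifting) less_irrefl mem_Collect_eq not_le)
    show "d \<le> Sup {d'. 0 < emeasure lebesgue {r. d' \<le> level_dim f r F}}"
      using below[of d] by (intro Sup_upper) simp
  qed
qed

lemma D_star_fun_eq_0:
  assumes null: "f ` F \<in> null_sets lebesgue"
  shows "D_star_fun f F = 0"
proof -
  have "d = 0" if d: "0 < emeasure lebesgue {r. d \<le> level_dim f r F}" for d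
  proof (rule ccontr)
    assume "d \<noteq> 0"
    then have "{r. d \<le> level_dim f r F} \<subseteq> f ` F" using level_dim_outside_image[of _ f] by fastforce
    then have "{r. d \<le> level_dim f r F} \<in> null_sets lebesgue" using null by (rule null_sets_completion_subset)
    then show False using d by auto
  qed
  then have "D_star_fun f F \<le> 0"
    unfolding D_star_fun_def by (intro Sup_least) auto
  then show ?thesis by simp
qed

text \<open>
  Each dense \<open>G\<^sub>\<delta>\<close> set contains a function with the generic value \<open>d\<close>, so no infimum exceeds \<open>d\<close>;
  the infimum \<open>d\<close> itself is attained on a dense \<open>G\<^sub>\<delta>\<close> set on which the value is constant.
\<close>
lemma D_star_eq_generic_value:
  assumes "generic {f. D_star_fun f F = d}"
  shows "D_star \<alpha> F = d"
  unfolding D_star_def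
proof (rule antisym)
  show "(SUP \<G>\<in>dense_gdeltas \<alpha> F. INF f\<in>\<G>. D_star_fun f F) \<le> d"
  proof (rule SUP_least)
    fix G assume "G \<in> dense_gdeltas \<alpha> F"
    then have "generic (G \<inter> {f. D_star_fun f F = d})"
      by (rule generic_Int[OF dense_gdelta_generic assms])
    from generic_nonempty[OF this] obtain f where "f \<in> G" "D_star_fun f F = d" by blast
    then show "(INF f\<in>G. D_star_fun f F) \<le> d" by (metis INF_lower)
  qed
  obtain G where G: "G \<in> dense_gdeltas \<alpha> F" "G \<subseteq> {f. D_star_fun f F = d}"
    using generic_contains_dense_gdelta[OF assms] by metis
  have "d \<le> (INF f\<in>G. D_star_fun f F)" using G(2) by (intro INF_greatest) auto
  then show "d \<le> (SUP \<G>\<in>dense_gdeltas \<alpha> F. INF f\<in>\<G>. D_star_fun f F)"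
    by (rule SUP_upper2[OF G(1)])
qed

end

context holder_functions_with_copies
begin

lemma generic_image_positive:
  assumes xy: "x \<in> F" "y \<in> F" "x \<noteq> y"
  shows "generic {f. f \<in> X \<longrightarrow> 0 < emeasure lebesgue (f ` F)}"
proof -
  have pos: "0 < emeasure lebesgue (f ` F)" if f: "f \<in> X" "f x \<noteq> f y" for f
  proof -
    obtain l u where lu: "f ` F = {l..u}" using image_interval[OF f(1)] .
    then have "f x \<in> {l..u}" "f y \<in> {l..u}" using xy by auto
    then have "l < u" using f(2) by auto
    then show ?thesis by (simp add: lu)
  qed
  have "generic {f. f x \<noteq> f y}"
  proof (rule generic_if_densely_stable)
    fix f and e :: real assume f: "f \<in> X" and e: "0 < e"
    have "\<exists>g\<in>X. close e f g \<and> g x \<noteq> g y"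
    proof (cases "f x = f y")
      case False
      then show ?thesis using f e by (intro bexI[of _ f]) (auto simp: close_def)
    next
      case True
      define D where "D = min e (dist x y powr \<alpha>)"
      have D: "0 < D" "D \<le> e" "D \<le> dist x y powr \<alpha>" using e xy by (auto simp: D_def)
      define v where "v z = (if z = x then f x else f x + D)" for z
      have v_holder: "v z \<le> v z' + dist z z' powr \<alpha>" if "z \<in> {x, y}" "z' \<in> {x, y}" for z z'
        using that xy D by (auto simp: v_def dist_commute)
      have v_near: "\<bar>v z - f z\<bar> \<le> e" if "z \<in> {x, y}" for z
        using that xy D True e by (auto simp: v_def)
      have in_F: "z \<in> F" if "z \<in> {x, y}" for z using that xy by auto
      obtain g where g: "g \<in> X" "g x = v x" "g y = v y" "close e f g"
        using holder_extension_near[where I = "{x, y}" and p = "\<lambda>z. z" and v = v,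
            OF f in_F less_imp_le[OF e] v_holder v_near]
        by (metis insertI1 insertI2)
      then have "g x \<noteq> g y" using D(1) xy(3) by (simp add: v_def)
      then show ?thesis using g by blast
    qed
    then obtain g where g: "g \<in> X" "close e f g" "g x \<noteq> g y" by blast
    have "h x \<noteq> h y" if "close (\<bar>g x - g y\<bar> / 3) g h" for h
    proof
      assume "h x = h y"
      moreover have "\<bar>g x - h x\<bar> \<le> \<bar>g x - g y\<bar> / 3" "\<bar>g y - h y\<bar> \<le> \<bar>g x - g y\<bar> / 3"
        using that xy by (auto simp: close_def)
      ultimately show False using g(3) by (simp add: abs_if split: if_splits)
    qed
    then show "\<exists>g\<in>X. close e f g \<and> (\<exists>d>0. \<forall>h\<in>X. close d g h \<longrightarrow> h x \<noteq> h y)"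
      using g by (intro bexI[of _ g] conjI exI[of _ "\<bar>g x - g y\<bar> / 3"]) auto
  qed
  then show ?thesis by (rule generic_CollectI) (use pos in auto)
qed

text \<open>
  \<open>S\<close> consists of the rational exponents for which almost all level sets are generically null. A
  level set that is null exactly for the exponents in \<open>S\<close>, among all positive rationals, has dimension
  between the supremum over the other exponents and the infimum over \<open>S\<close>. These agree, because every
  positive rational belongs to one of the two sets.
\<close>
lemma generic_level_dim_constant:
  obtains d where "generic {f. AE r in lebesgue. r \<in> f ` F \<longrightarrow> level_dim f r F = d}"
proof -
  define N where "N s = {f. emeasure lborel (non_null s f) = 0}" for s
  define Q where "Q = {s :: real. s \<in> \<rat> \<and> 0 < s}"
  define S where "S = {s \<in> Q. generic (N s)}"
  define E where "E s = (if s \<in> S then N s else {f. emeasure lborel (f ` F - non_null s f) = 0})" for s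
  define d where "d = (SUP s \<in> Q - S. ennreal s)"
  have INF_le: "(INF s \<in> S. ennreal s) \<le> d"
  proof (rule ccontr)
    assume "\<not> (INF s \<in> S. ennreal s) \<le> d"
    then obtain r where r: "d < ennreal (real_of_rat r)" "ennreal (real_of_rat r) < (INF s \<in> S. ennreal s)"
      using ennreal_rat_dense by (metis not_le)
    have "0 < ennreal (real_of_rat r)" using r(1) by (rule le_less_trans[OF zero_le])
    then have Q: "real_of_rat r \<in> Q" by (simp add: Q_def)
    show False
    proof (cases "real_of_rat r \<in> S")
      case True
      then have "(INF s \<in> S. ennreal s) \<le> ennreal (real_of_rat r)" by (rule INF_lower)
      then show False using r(2) by simp
    next
      case False
      then have "ennreal (real_of_rat r) \<le> d" unfolding d_def using Q by (intro SUP_upper) simp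
      then show False using r(1) by simp
    qed
  qed
  have "countable Q"
    by (rule countable_subset[of _ "\<rat>"]) (auto simp: Q_def countable_rat)
  moreover have "generic (E s)" if "s \<in> Q" for s
    using generic_null_or_full[of s] that by (auto simp: E_def S_def N_def Q_def)
  ultimately have "generic (\<Inter>s\<in>Q. E s)" by (rule generic_INT)
  moreover have "AE r in lebesgue. r \<in> f ` F \<longrightarrow> level_dim f r F = d" if f: "f \<in> X" "f \<in> (\<Inter>s\<in>Q. E s)" for f
  proof (rule AE_completion)
    have "AE r in lborel. r \<in> f ` F \<longrightarrow> (hausdorff_measure s (level f r) = 0 \<longleftrightarrow> s \<in> S)" if s: "s \<in> Q" for s
    proof -
      have s_pos: "0 < s" using s by (simp add: Q_def)
      have meas: "non_null s f \<in> sets borel" "f ` F \<in> sets borel"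
        using non_null_borel[OF f(1) s_pos] image_compact[OF f(1)] by (auto intro: borel_compact)
      show ?thesis
      proof (cases "s \<in> S")
        case True
        then have "non_null s f \<in> null_sets lborel"
          using f(2) s meas by (auto simp: E_def N_def intro!: null_setsI)
        then show ?thesis
          by (rule AE_I') (use True in \<open>auto simp: non_null_def\<close>)
      next
        case False
        then have "f ` F - non_null s f \<in> null_sets lborel"
          using f(2) s meas by (intro null_setsI) (auto simp: E_def)
        then show ?thesis
          by (rule AE_I') (use False in \<open>auto simp: non_null_def\<close>)
      qed
    qed
    then have "AE r in lborel. \<forall>s\<in>Q. r \<in> f ` F \<longrightarrow> (hausdorff_measure s (level f r) = 0 \<longleftrightarrow> s \<in> S)"
      by (subst AE_ball_countable[OF \<open>countable Q\<close>]) blast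
    then show "AE r in lborel. r \<in> f ` F \<longrightarrow> level_dim f r F = d"
    proof (rule AE_mp, intro AE_I2 impI)
      fix r assume *: "\<forall>s\<in>Q. r \<in> f ` F \<longrightarrow> (hausdorff_measure s (level f r) = 0 \<longleftrightarrow> s \<in> S)" and r: "r \<in> f ` F"
      show "level_dim f r F = d"
      proof (rule antisym)
        have "level_dim f r F \<le> (INF s \<in> S. ennreal s)"
          unfolding level_dim_def
        proof (rule INF_greatest)
          fix s assume s: "s \<in> S"
          then have "s \<in> Q" by (simp add: S_def)
          then show "hausdorff_dim (level f r) \<le> ennreal s"
            using * r s by (intro hausdorff_dim_le) (auto simp: Q_def)
        qed
        then show "level_dim f r F \<le> d" using INF_le by (rule order_trans)
        show "d \<le> level_dim f r F"
          unfolding d_def level_dim_def using * r by (intro SUP_least hausdorff_dim_ge) auto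
      qed
    qed
  qed
  ultimately have "generic {f. AE r in lebesgue. r \<in> f ` F \<longrightarrow> level_dim f r F = d}"
    by (rule generic_CollectI)
  then show ?thesis by (rule that)
qed

text \<open>
  If \<open>F\<close> is a single point, then \<open>f ` F\<close> is a null set for every \<open>f\<close>, and all quantities vanish.
\<close>
theorem generic_level_dimension:
  "\<exists>\<G> \<in> dense_gdeltas \<alpha> F. \<forall>f\<in>\<G>. D_star \<alpha> F = D_star_fun f F \<and>
     (AE r in lebesgue. r \<in> f ` F \<longrightarrow> level_dim f r F = D_star_fun f F)"
proof (cases "\<exists>x\<in>F. \<exists>y\<in>F. x \<noteq> y")
  case True
  then obtain x y where xy: "x \<in> F" "y \<in> F" "x \<noteq> y" by blast
  obtain d where d: "generic {f. AE r in lebesgue. r \<in> f ` F \<longrightarrow> level_dim f r F = d}"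
    using generic_level_dim_constant .
  let ?A = "{f. D_star_fun f F = d \<and> (AE r in lebesgue. r \<in> f ` F \<longrightarrow> level_dim f r F = d)}"
  have A: "generic ?A"
    by (rule generic_mono[OF generic_Int[OF d generic_image_positive[OF xy]]]) (auto intro: D_star_fun_eq)
  then have "generic {f. D_star_fun f F = d}" by (rule generic_mono) auto
  then have "D_star \<alpha> F = d" by (rule D_star_eq_generic_value)
  moreover obtain G where G: "G \<in> dense_gdeltas \<alpha> F" "G \<subseteq> ?A" "G \<subseteq> X"
    by (rule generic_contains_dense_gdelta[OF A])
  ultimately have "D_star \<alpha> F = D_star_fun f F \<and>
      (AE r in lebesgue. r \<in> f ` F \<longrightarrow> level_dim f r F = D_star_fun f F)" if "f \<in> G" for f
    using subsetD[OF G(2) that] by auto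
  with G(1) show ?thesis by (intro bexI[of _ G] ballI)
next
  case False
  then obtain a where F: "F = {a}" using F_nonempty by blast
  have null: "f ` F \<in> null_sets lebesgue" for f :: "'a \<Rightarrow> real"
    unfolding F by (simp add: null_sets_completionI)
  have zero: "D_star_fun f F = 0" for f by (rule D_star_fun_eq_0[OF null])
  have gen: "generic {f. D_star_fun f F = 0}"
    using open_dense_imp_generic[OF open_dense_X] by (rule generic_mono) (simp add: zero)
  obtain G where G: "G \<in> dense_gdeltas \<alpha> F" "G \<subseteq> {f. D_star_fun f F = 0}" "G \<subseteq> X"
    by (rule generic_contains_dense_gdelta[OF gen])
  have "AE r in lebesgue. r \<in> f ` F \<longrightarrow> level_dim f r F = D_star_fun f F" for f :: "'a \<Rightarrow> real"
    by (rule AE_I'[OF null[of f]]) auto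
  then show ?thesis
    using D_star_eq_generic_value[OF gen] zero G(1) by (intro bexI[of _ G] ballI conjI) auto
qed

end

text \<open>
  Follow the address of \<open>x\<close> until the product of the ratios first drops to \<open>\<rho>\<close> or below; the last step
  loses at most the smallest ratio \<open>q0\<close>. Induction on \<open>n\<close> with \<open>q1 ^ n \<le> \<rho>\<close>, for the largest ratio
  \<open>q1\<close>, bounds the number of steps.
\<close>
lemma self_similar_set_copies:
  fixes F :: "(real ^ 'p) set"
  assumes "self_similar_set F"
  obtains q0 where "0 < q0" "\<And>x \<rho>. x \<in> F \<Longrightarrow> 0 < \<rho> \<Longrightarrow> \<rho> \<le> 1 \<Longrightarrow>
      \<exists>\<psi> q. q0 * \<rho> \<le> q \<and> q \<le> \<rho> \<and> similarity_with_ratio q \<psi> \<and> \<psi> ` F \<subseteq> F \<and> x \<in> \<psi> ` F"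
proof -
  obtain m :: nat and \<phi> :: "nat \<Rightarrow> real ^ 'p \<Rightarrow> real ^ 'p" and q :: "nat \<Rightarrow> real" where
    m: "2 \<le> m" and q: "\<And>i. i \<in> {1..m} \<Longrightarrow> 0 < q i \<and> q i < 1 \<and> similarity_with_ratio (q i) (\<phi> i)"
    and F: "F = (\<Union>i\<in>{1..m}. \<phi> i ` F)"
    using assms unfolding self_similar_set_def by metis
  define q0 where "q0 = Min (q ` {1..m})"
  define q1 where "q1 = Max (q ` {1..m})"
  have ne: "finite (q ` {1..m})" "q ` {1..m} \<noteq> {}" using m by auto
  have "q0 \<in> q ` {1..m}" "q1 \<in> q ` {1..m}" unfolding q0_def q1_def using ne by (auto intro!: Min_in Max_in)
  then have q01: "0 < q0" "q0 < 1" "0 < q1" "q1 < 1" using q by auto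
  have bounds: "q0 \<le> q i" "q i \<le> q1" if "i \<in> {1..m}" for i
    unfolding q0_def q1_def using that ne by (auto intro: Min_le Max_ge)
  have step: "\<exists>\<psi> p. q0 * \<rho> \<le> p \<and> p \<le> \<rho> \<and> similarity_with_ratio p \<psi> \<and> \<psi> ` F \<subseteq> F \<and> x \<in> \<psi> ` F"
    if "x \<in> F" "q1 ^ n \<le> \<rho>" "\<rho> \<le> 1" for n x \<rho>
    using that
  proof (induction n arbitrary: x \<rho>)
    case 0
    then have "\<rho> = 1" by simp
    then show ?case
      using 0 q01 by (intro exI[of _ "\<lambda>x. x"] exI[of _ 1]) (auto simp: similarity_with_ratio_def)
  next
    case (Suc n)
    have \<rho>: "0 < \<rho>" using Suc.prems(2) q01(3) by (meson less_le_trans zero_less_power)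
    obtain i y where i: "i \<in> {1..m}" and y: "y \<in> F" "x = \<phi> i y" using Suc.prems(1) F by blast
    have \<phi>F: "\<phi> i ` F \<subseteq> F" using F i by blast
    note qi = q[OF i]
    show ?case
    proof (cases "\<rho> \<le> q i")
      case True
      have "q1 ^ n * q i \<le> q1 ^ n * q1" using bounds(2)[OF i] q01(3) by simp
      then have "q1 ^ n * q i \<le> \<rho>" using Suc.prems(2) by (simp add: mult.commute)
      then have "q1 ^ n \<le> \<rho> / q i" using qi by (simp add: pos_le_divide_eq)
      moreover have "\<rho> / q i \<le> 1" using True qi by simp
      ultimately obtain \<psi> p where p: "q0 * (\<rho> / q i) \<le> p" "p \<le> \<rho> / q i" "similarity_with_ratio p \<psi>" 
          "\<psi> ` F \<subseteq> F" "y \<in> \<psi> ` F"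
        using Suc.IH[OF y(1)] by metis
      show ?thesis
      proof (intro exI[of _ "\<phi> i \<circ> \<psi>"] exI[of _ "q i * p"] conjI)
        show "q0 * \<rho> \<le> q i * p" "q i * p \<le> \<rho>" using p(1,2) qi by (auto simp: field_simps)
        show "similarity_with_ratio (q i * p) (\<phi> i \<circ> \<psi>)"
          using p(3) qi by (simp add: similarity_with_ratio_def)
        show "(\<phi> i \<circ> \<psi>) ` F \<subseteq> F" using p(4) \<phi>F by (auto simp: image_subset_iff)
        show "x \<in> (\<phi> i \<circ> \<psi>) ` F" using p(5) y(2) by auto
      qed
    next
      case False
      have "q0 * \<rho> \<le> q0" using Suc.prems(3) q01(1) by (simp add: mult_left_le)
      then show ?thesis
        using False qi bounds(1)[OF i] \<phi>F y by (intro exI[of _ "\<phi> i"] exI[of _ "q i"]) auto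
    qed
  qed
  show ?thesis
  proof (rule that[OF q01(1)])
    fix x \<rho> assume "x \<in> F" "0 < \<rho>" "\<rho> \<le> (1 :: real)"
    moreover obtain n where "q1 ^ n < \<rho>" using real_arch_pow_inv[OF \<open>0 < \<rho>\<close> q01(4)] by blast
    ultimately show "\<exists>\<psi> q. q0 * \<rho> \<le> q \<and> q \<le> \<rho> \<and> similarity_with_ratio q \<psi> \<and> \<psi> ` F \<subseteq> F \<and> x \<in> \<psi> ` F"
      using step[of x n \<rho>] by simp
  qed
qed

theorem theorem3p5:
  fixes F :: "(real ^ 'p) set" and \<alpha> :: real
  assumes "self_similar_set F" and "connected F"
    and "0 < \<alpha>" and "\<alpha> < 1"
  shows "\<exists>\<G> \<in> dense_gdeltas \<alpha> F. \<forall>f\<in>\<G>.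
           D_star \<alpha> F = D_star_fun f F \<and>
           (AE r in lebesgue. r \<in> f ` F \<longrightarrow> level_dim f r F = D_star_fun f F)"
proof -
  obtain q0 where q0: "0 < q0" "\<And>x \<rho>. x \<in> F \<Longrightarrow> 0 < \<rho> \<Longrightarrow> \<rho> \<le> 1 \<Longrightarrow>
      \<exists>\<psi> q. q0 * \<rho> \<le> q \<and> q \<le> \<rho> \<and> similarity_with_ratio q \<psi> \<and> \<psi> ` F \<subseteq> F \<and> x \<in> \<psi> ` F"
    using self_similar_set_copies[OF assms(1)] by metis
  interpret holder_functions_with_copies F \<alpha> q0
    using assms q0 by unfold_locales (auto simp: self_similar_set_def)
  show ?thesis by (rule generic_level_dimension)
qed

end
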